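(* In dimension one, $G_Q(1)=G(1)/4=\pi^2/16$, and the infimum defining $G_Q(1)$ is not attained.
   Context: $G(1)=\inf_{0\ne u\in H^1(\mathbb{R})}\frac{\int_{\mathbb{R}}(u')^2\left(\int_{\mathbb{R}}u^2\right)^{2}}{\int_{\mathbb{R}}u^{6}}$. With $I=[0,1]$, $G_Q(1)=\inf\frac{\int_I (u')^2\left(\int_I u^2\right)^2}{\int_I|u-u_I|^{6}}$, the infimum over (non-constant) $u\in W^{1,1}(I)$, where $u_I=\int_I u$. *)

theory Defs
  imports "HOL-Analysis.Analysis"
begin

definition test_fun :: "real set \<Rightarrow> (real \<Rightarrow> real) \<Rightarrow> bool" where
  "test_fun U \<phi> \<longleftrightarrow>
     (\<forall>k::nat. \<forall>x. ((deriv ^^ k) \<phi>) differentiable (at x)) \<and>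
     compact (closure {x. \<phi> x \<noteq> 0}) \<and> closure {x. \<phi> x \<noteq> 0} \<subseteq> U"

definition weak_deriv_on :: "real set \<Rightarrow> (real \<Rightarrow> real) \<Rightarrow> (real \<Rightarrow> real) \<Rightarrow> bool" where
  "weak_deriv_on U u g \<longleftrightarrow>
     (\<forall>\<phi>. test_fun U \<phi> \<longrightarrow>
        (LINT x:U|lborel. u x * deriv \<phi> x) = - (LINT x:U|lborel. g x * \<phi> x))"

definition W11_I :: "(real \<Rightarrow> real) \<Rightarrow> (real \<Rightarrow> real) \<Rightarrow> bool" where
  "W11_I u g \<longleftrightarrow> set_integrable lborel {0<..<1} u \<and> set_integrable lborel {0<..<1} g \<and>
     weak_deriv_on {0<..<1} u g"

definition H1_R :: "(real \<Rightarrow> real) \<Rightarrow> (real \<Rightarrow> real) \<Rightarrow> bool" where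
  "H1_R u g \<longleftrightarrow> u \<in> borel_measurable lborel \<and> integrable lborel (\<lambda>x. (u x)^2) \<and>
     g \<in> borel_measurable lborel \<and> integrable lborel (\<lambda>x. (g x)^2) \<and>
     weak_deriv_on UNIV u g"

text \<open>Quotients, computed in [0,\<infinity>] (ennreal) so that infinite integrals are
  treated correctly (a/0 = \<infinity> for a > 0 never arises for admissible u).\<close>
definition G_ratio :: "(real \<Rightarrow> real) \<Rightarrow> (real \<Rightarrow> real) \<Rightarrow> ennreal" where
  "G_ratio u g =
     (\<integral>\<^sup>+ x. ennreal ((g x)^2) \<partial>lborel) * (\<integral>\<^sup>+ x. ennreal ((u x)^2) \<partial>lborel)^2
       / (\<integral>\<^sup>+ x. ennreal ((u x)^6) \<partial>lborel)"

definition G1 :: ennreal where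
  "G1 = Inf {G_ratio u g | u g. H1_R u g \<and> \<not> (AE x in lborel. u x = 0)}"

definition mean_I :: "(real \<Rightarrow> real) \<Rightarrow> real" where
  "mean_I u = (LINT x:{0..1}|lborel. u x)"

definition GQ_ratio :: "(real \<Rightarrow> real) \<Rightarrow> (real \<Rightarrow> real) \<Rightarrow> ennreal" where
  "GQ_ratio u g =
     (\<integral>\<^sup>+ x\<in>{0..1}. ennreal ((g x)^2) \<partial>lborel) * (\<integral>\<^sup>+ x\<in>{0..1}. ennreal ((u x)^2) \<partial>lborel)^2
       / (\<integral>\<^sup>+ x\<in>{0..1}. ennreal (\<bar>u x - mean_I u\<bar>^6) \<partial>lborel)"

definition GQ_admissible :: "(real \<Rightarrow> real) \<Rightarrow> (real \<Rightarrow> real) \<Rightarrow> bool" where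
  "GQ_admissible u g \<longleftrightarrow> W11_I u g \<and> \<not> (\<exists>c. AE x in lborel. x \<in> {0..1} \<longrightarrow> u x = c)"

definition GQ1 :: ennreal where
  "GQ1 = Inf {GQ_ratio u g | u g. GQ_admissible u g}"

end

theory Submission
  imports Defs "HOL-Computational_Algebra.Polynomial"
begin

text \<open>In the mass variable s = \<integral> v^2, the function w = v^2 satisfies
  \<integral> v^6 dx = \<integral> w^2 ds and \<integral> (v')^2 dx = 1/4 \<integral> (w')^2 ds, so both constants come from Wirtinger's
  inequality on an interval of length M, the total mass: with w vanishing at both ends for the
  line, at one end for a half-line. A mean-zero function on [0,1] has a sign change; cutting there
  leaves two functions vanishing at one endpoint, each with strictly less than the whole mass, which
  makes the inequality strict. The extremal sqrt (sech x) on the line, rescaled so as to concentrate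
  at the endpoint 0 of [0,1], shows that the constants are optimal.\<close>

section \<open>Indefinite Lebesgue integrals\<close>

text \<open>The substitution by mass is never carried out: \<open>v\<close> may vanish on whole
  intervals, so the running mass need not be invertible. The calibration is pulled back to x
  instead, with an angle \<theta> affine in the running mass; the only regularity used is that
  \<open>v\<close> is an indefinite integral of \<open>g\<close>, which is what
  \<open>primitive_on\<close> records. The cotangent blows up at angles 0 and pi, so the mass is
  enlarged in the choice of \<open>k\<close> by a multiple of some \<epsilon> that is later sent to
  0. The constants are \<open>k^2 / 4\<close> times the squared mass: an angle range pi gives
  pi^2/4, a range pi/2, for one free endpoint, gives pi^2/16. In the lower bounds, weak
  differentiability enters only through the du Bois-Reymond lemma, which supplies a representative
  of the \<open>primitive_on\<close> kind; as \<open>test_fun\<close> asks for smooth functions,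
  explicit bumps are built for it. The quotient on [0,1] has the mean removed in the denominator
  only: harmless from below, because removing the mean does not increase the L^2 norm, and
  asymptotically harmless for the concentrating family, whose mean tends to 0.\<close>

definition primitive_on :: "real \<Rightarrow> real \<Rightarrow> (real \<Rightarrow> real) \<Rightarrow> (real \<Rightarrow> real) \<Rightarrow> bool" where
  "primitive_on a b f g \<longleftrightarrow> set_integrable lborel {a..b} g \<and>
     (\<forall>x\<in>{a..b}. f x = f a + (LINT t:{a..x}|lborel. g t))"

lemma LINT_Icc_split:
  fixes f :: "real \<Rightarrow> real"
  assumes "set_integrable lborel {a..c} f" "a \<le> b" "b \<le> c"
  shows "(LINT x:{a..c}|lborel. f x) = (LINT x:{a..b}|lborel. f x) + (LINT x:{b..c}|lborel. f x)"
proof -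
  have i: "set_integrable lborel {a..b} f" "set_integrable lborel {b..c} f"
    using assms by (auto intro: set_integrable_subset)
  show ?thesis
    using i assms Henstock_Kurzweil_Integration.integral_combine[of a b c f]
    by (simp add: set_borel_integral_eq_integral)
qed

lemma primitive_on_LINT:
  assumes "primitive_on a b f g" "a \<le> x" "x \<le> y" "y \<le> b"
  shows "(LINT t:{x..y}|lborel. g t) = f y - f x"
proof -
  have "(LINT t:{a..y}|lborel. g t) = (LINT t:{a..x}|lborel. g t) + (LINT t:{x..y}|lborel. g t)"
    using assms by (intro LINT_Icc_split) (auto simp: primitive_on_def intro: set_integrable_subset)
  moreover have "f x = f a + (LINT t:{a..x}|lborel. g t)" "f y = f a + (LINT t:{a..y}|lborel. g t)"
    using assms(2-4) assms(1)[unfolded primitive_on_def] by (meson atLeastAtMost_iff order_trans)+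
  ultimately show ?thesis by simp
qed

lemma primitive_on_subinterval:
  assumes "primitive_on a b f g" "a \<le> c" "d \<le> b"
  shows "primitive_on c d f g"
proof -
  have "set_integrable lborel {c..d} g"
    using assms unfolding primitive_on_def by (auto intro: set_integrable_subset)
  moreover have "f x = f c + (LINT t:{c..x}|lborel. g t)" if "x \<in> {c..d}" for x
    using that assms primitive_on_LINT[OF assms(1), of c x] by auto
  ultimately show ?thesis unfolding primitive_on_def by blast
qed

lemma primitive_on_continuous:
  assumes "primitive_on a b f g"
  shows "continuous_on {a..b} f"
proof -
  have si: "set_integrable lborel {a..x} g" if "x \<in> {a..b}" for x
    using assms that unfolding primitive_on_def by (auto intro: set_integrable_subset)
  have "g integrable_on {a..b}"
    using assms set_borel_integral_eq_integral(1) unfolding primitive_on_def by blast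
  then have "continuous_on {a..b} (\<lambda>x. f a + integral {a..x} g)"
    by (intro continuous_intros indefinite_integral_continuous_1)
  then show ?thesis
    by (rule continuous_on_eq)
       (use assms si in \<open>metis primitive_on_def set_borel_integral_eq_integral(2)\<close>)
qed

lemma primitive_on_C1:
  assumes "\<And>x. a \<le> x \<Longrightarrow> x \<le> b \<Longrightarrow> (f has_real_derivative g x) (at x within {a..b})"
    and "continuous_on {a..b} g"
  shows "primitive_on a b f g"
proof -
  have si: "set_integrable lborel {a..x} g" if "x \<in> {a..b}" for x
    using that by (intro borel_integrable_atLeastAtMost' continuous_on_subset[OF assms(2)]) auto
  have "f x = f a + (LINT t:{a..x}|lborel. g t)" if x: "x \<in> {a..b}" for x
  proof -
    have "(g has_integral f x - f a) {a..x}"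
    proof (rule fundamental_theorem_of_calculus)
      fix y assume "y \<in> {a..x}"
      then have "(f has_real_derivative g y) (at y within {a..x})"
        using x by (intro DERIV_subset[OF assms(1)]) auto
      then show "(f has_vector_derivative g y) (at y within {a..x})"
        by (simp add: has_real_derivative_iff_has_vector_derivative)
    qed (use x in auto)
    then show ?thesis
      using si[OF x] by (simp add: set_borel_integral_eq_integral(2) integral_unique)
  qed
  moreover have "set_integrable lborel {a..b} g"
    using assms(2) by (rule borel_integrable_atLeastAtMost')
  ultimately show ?thesis unfolding primitive_on_def by blast
qed

lemma set_integrable_continuous_mult:
  fixes f g :: "real \<Rightarrow> real"
  assumes f: "continuous_on {a..b} f" and g: "set_integrable lborel {a..b} g"
  shows "set_integrable lborel {a..b} (\<lambda>x. f x * g x)"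
proof -
  have "bounded (f ` {a..b})"
    using f by (intro compact_imp_bounded compact_continuous_image) auto
  then obtain B where "\<forall>y\<in>f ` {a..b}. norm y \<le> B"
    unfolding bounded_iff by blast
  then have B: "\<bar>f x\<bar> \<le> B" if "x \<in> {a..b}" for x
    using that by auto
  have fm: "(\<lambda>x. indicator {a..b} x *\<^sub>R f x) \<in> borel_measurable lborel"
    using borel_integrable_atLeastAtMost'[OF f] unfolding set_integrable_def by auto
  have gm: "(\<lambda>x. indicator {a..b} x *\<^sub>R g x) \<in> borel_measurable lborel"
    using g unfolding set_integrable_def by auto
  \<comment> \<open>Neither factor need be measurable outside the interval, so both are truncated
    first; the squared indicator is again the indicator.\<close>
  have "(\<lambda>x. (indicator {a..b} x *\<^sub>R f x) * (indicator {a..b} x *\<^sub>R g x)) \<in> borel_measurable lborel"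
    using fm gm by measurable
  also have "(\<lambda>x. (indicator {a..b} x *\<^sub>R f x) * (indicator {a..b} x *\<^sub>R g x))
     = (\<lambda>x. indicator {a..b} x *\<^sub>R (f x * g x))"
    by (auto simp: indicator_def)
  finally have m: "set_borel_measurable lborel {a..b} (\<lambda>x. f x * g x)"
    unfolding set_borel_measurable_def .
  show ?thesis
  proof (rule set_integrable_bound[OF set_integrable_mult_right[OF g, of B] m])
    show "AE x in lborel. x \<in> {a..b} \<longrightarrow> norm (f x * g x) \<le> norm (B * g x)"
    proof (intro AE_I2 impI)
      fix x assume "x \<in> {a..b}"
      from B[OF this] show "norm (f x * g x) \<le> norm (B * g x)"
        by (auto simp: abs_mult intro!: mult_right_mono)
    qed
  qed
qed

text \<open>Fubini over the half-plane t \<le> s; the full product \<open>F s * H t\<close>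
  dominates the truncated one and is integrable since it factorizes. This replaces the pointwise
  product rule, which holds only almost everywhere for indefinite integrals.\<close>

lemma integral_triangle_swap:
  fixes F H :: "real \<Rightarrow> real"
  assumes F: "integrable lborel F" and H: "integrable lborel H"
  shows "(\<integral>t. H t * (\<integral>s. indicator {t..} s * F s \<partial>lborel) \<partial>lborel)
       = (\<integral>s. F s * (\<integral>t. indicator {..s} t * H t \<partial>lborel) \<partial>lborel)"
proof -
  have [measurable]: "F \<in> borel_measurable borel" "H \<in> borel_measurable borel"
    using F H by auto
  have int: "integrable (lborel \<Otimes>\<^sub>M lborel) (\<lambda>(s, t). F s * H t)"
  proof (rule lborel_pair.Fubini_integrable)
    show "integrable lborel (\<lambda>x. \<integral>y. norm (case (x, y) of (s, t) \<Rightarrow> F s * H t) \<partial>lborel)"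
      using F H by (simp add: abs_mult)
    show "AE x in lborel. integrable lborel (\<lambda>y. case (x, y) of (s, t) \<Rightarrow> F s * H t)"
      using H by simp
  qed measurable
  have "integrable (lborel \<Otimes>\<^sub>M lborel) (\<lambda>(s, t). if t \<le> s then F s * H t else 0)"
    by (rule Bochner_Integration.integrable_bound[OF int]) auto
  from lborel_pair.Fubini_integral[OF this]
  have "(\<integral>t. (\<integral>s. (if t \<le> s then F s * H t else 0) \<partial>lborel) \<partial>lborel)
      = (\<integral>s. (\<integral>t. (if t \<le> s then F s * H t else 0) \<partial>lborel) \<partial>lborel)" .
  moreover have "(\<lambda>s. if t \<le> s then F s * H t else 0) = (\<lambda>s. H t * (indicator {t..} s * F s))" for t
    by (auto simp: indicator_def)
  moreover have "(\<lambda>t. if t \<le> s then F s * H t else 0) = (\<lambda>t. F s * (indicator {..s} t * H t))" for s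
    by (auto simp: indicator_def)
  ultimately show ?thesis by simp
qed

text \<open>With \<open>F\<close> and \<open>H\<close> the derivatives cut off outside [a,b], the
  inner integrals of the triangle identity are \<open>f b - f t\<close> and
  \<open>h s - h a\<close>; expanding both sides leaves the boundary terms.\<close>

lemma primitive_on_by_parts:
  assumes f: "primitive_on a b f f'" and h: "primitive_on a b h h'" and "a \<le> b"
  shows "(LINT x:{a..b}|lborel. h x * f' x + f x * h' x) = f b * h b - f a * h a"
proof -
  define F where "F = (\<lambda>x. indicator {a..b} x *\<^sub>R f' x)"
  define H where "H = (\<lambda>x. indicator {a..b} x *\<^sub>R h' x)"
  have fi: "set_integrable lborel {a..b} f'" and hi: "set_integrable lborel {a..b} h'"
    using f h unfolding primitive_on_def by auto
  have FH: "integrable lborel F" "integrable lborel H"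
    using fi hi unfolding F_def H_def set_integrable_def by auto
  have 1: "(\<integral>s. indicator {t..} s * F s \<partial>lborel) = f b - f t" if t: "t \<in> {a..b}" for t
  proof -
    have "(\<integral>s. indicator {t..} s * F s \<partial>lborel) = (LINT s:{t..b}|lborel. f' s)"
      unfolding set_lebesgue_integral_def F_def
      by (rule Bochner_Integration.integral_cong) (use t in \<open>auto simp: indicator_def\<close>)
    with primitive_on_LINT[OF f, of t b] t show ?thesis by simp
  qed
  have 2: "(\<integral>t. indicator {..s} t * H t \<partial>lborel) = h s - h a" if s: "s \<in> {a..b}" for s
  proof -
    have "(\<integral>t. indicator {..s} t * H t \<partial>lborel) = (LINT t:{a..s}|lborel. h' t)"
      unfolding set_lebesgue_integral_def H_def
      by (rule Bochner_Integration.integral_cong) (use s in \<open>auto simp: indicator_def\<close>)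
    with primitive_on_LINT[OF h, of a s] s show ?thesis by simp
  qed
  have hf: "set_integrable lborel {a..b} (\<lambda>x. h x * f' x)"
    by (intro set_integrable_continuous_mult primitive_on_continuous[OF h] fi)
  have fh: "set_integrable lborel {a..b} (\<lambda>x. f x * h' x)"
    by (intro set_integrable_continuous_mult primitive_on_continuous[OF f] hi)
  have "(\<integral>t. H t * (\<integral>s. indicator {t..} s * F s \<partial>lborel) \<partial>lborel) = (LINT x:{a..b}|lborel. f b * h' x - f x * h' x)"
    unfolding set_lebesgue_integral_def
  proof (rule Bochner_Integration.integral_cong)
    show "H t * (\<integral>s. indicator {t..} s * F s \<partial>lborel) = indicator {a..b} t *\<^sub>R (f b * h' t - f t * h' t)" for t
      by (cases "t \<in> {a..b}") (simp_all add: 1 right_diff_distrib', simp_all add: H_def algebra_simps)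
  qed simp
  moreover have "(\<integral>s. F s * (\<integral>t. indicator {..s} t * H t \<partial>lborel) \<partial>lborel) = (LINT x:{a..b}|lborel. h x * f' x - h a * f' x)"
    unfolding set_lebesgue_integral_def
  proof (rule Bochner_Integration.integral_cong)
    show "F s * (\<integral>t. indicator {..s} t * H t \<partial>lborel) = indicator {a..b} s *\<^sub>R (h s * f' s - h a * f' s)" for s
      by (cases "s \<in> {a..b}") (simp_all add: 2 right_diff_distrib', simp_all add: F_def algebra_simps)
  qed simp
  ultimately have "(LINT x:{a..b}|lborel. f b * h' x - f x * h' x) = (LINT x:{a..b}|lborel. h x * f' x - h a * f' x)"
    using integral_triangle_swap[OF FH] by simp
  moreover have "(LINT x:{a..b}|lborel. f b * h' x - f x * h' x) = f b * (h b - h a) - (LINT x:{a..b}|lborel. f x * h' x)"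
    using fh hi primitive_on_LINT[OF h, of a b] \<open>a \<le> b\<close> by simp
  moreover have "(LINT x:{a..b}|lborel. h x * f' x - h a * f' x) = (LINT x:{a..b}|lborel. h x * f' x) - h a * (f b - f a)"
    using hf fi primitive_on_LINT[OF f, of a b] \<open>a \<le> b\<close> by simp
  ultimately show ?thesis using hf fh by (simp add: algebra_simps)
qed

lemma primitive_on_mult:
  assumes f: "primitive_on a b f f'" and h: "primitive_on a b h h'"
  shows "primitive_on a b (\<lambda>x. f x * h x) (\<lambda>x. h x * f' x + f x * h' x)"
proof -
  have "set_integrable lborel {a..b} (\<lambda>x. h x * f' x + f x * h' x)"
    by (intro set_integral_add(1) set_integrable_continuous_mult
          primitive_on_continuous[OF f] primitive_on_continuous[OF h])
       (use f h in \<open>simp_all only: primitive_on_def\<close>)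
  moreover have "f x * h x = f a * h a + (LINT t:{a..x}|lborel. h t * f' t + f t * h' t)"
    if "x \<in> {a..b}" for x
    using that primitive_on_by_parts[of a x f f' h h'] primitive_on_subinterval[OF f, of a x]
      primitive_on_subinterval[OF h, of a x] by auto
  ultimately show ?thesis unfolding primitive_on_def by blast
qed

section \<open>Weighted Wirtinger inequality\<close>

text \<open>This is \<open>\<integral> (g - k / 2 * cot \<theta> * v^3)^2 \<ge> 0\<close>: with \<open>\<theta>\<close> equal to k s up to a shift, the
  integrand is the square of w' - k cot(k s) w from the proof of Wirtinger's inequality, written in
  the variable x.\<close>

lemma cot_weighted_bound:
  assumes v: "primitive_on a b v g" and "a \<le> b"
    and g2: "set_integrable lborel {a..b} (\<lambda>x. (g x)\<^sup>2)"
    and \<theta>: "\<And>x. a \<le> x \<Longrightarrow> x \<le> b \<Longrightarrow> (\<theta> has_real_derivative k * (v x)\<^sup>2) (at x within {a..b})"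
    and s: "\<And>x. a \<le> x \<Longrightarrow> x \<le> b \<Longrightarrow> 0 < sin (\<theta> x)"
  shows "k\<^sup>2 / 4 * (LINT x:{a..b}|lborel. v x ^ 6) + k / 4 * (v b ^ 4 * cot (\<theta> b) - v a ^ 4 * cot (\<theta> a))
           \<le> (LINT x:{a..b}|lborel. (g x)\<^sup>2)"
proof -
  have cv: "continuous_on {a..b} v" by (rule primitive_on_continuous[OF v])
  have c\<theta>: "continuous_on {a..b} \<theta>"
    by (rule DERIV_continuous_on[of _ _ "\<lambda>x. k * (v x)\<^sup>2"]) (use \<theta> in auto)
  have snz: "sin (\<theta> x) \<noteq> 0" if "x \<in> {a..b}" for x
    using s[of x] that by auto
  have pc: "primitive_on a b (\<lambda>x. cot (\<theta> x)) (\<lambda>x. - inverse ((sin (\<theta> x))\<^sup>2) * (k * (v x)\<^sup>2))"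
  proof (rule primitive_on_C1)
    fix x assume x: "a \<le> x" "x \<le> b"
    have "(cot has_real_derivative - inverse ((sin (\<theta> x))\<^sup>2)) (at (\<theta> x))"
      using s[OF x] by (intro DERIV_cot) auto
    from DERIV_chain2[OF this \<theta>[OF x]]
    show "((\<lambda>x. cot (\<theta> x)) has_real_derivative - inverse ((sin (\<theta> x))\<^sup>2) * (k * (v x)\<^sup>2)) (at x within {a..b})" .
  qed (intro continuous_intros c\<theta> cv, use snz in auto)
  have p2: "primitive_on a b (\<lambda>x. v x * v x) (\<lambda>x. v x * g x + v x * g x)"
    by (rule primitive_on_mult[OF v v])
  \<comment> \<open>The derivative \<open>p\<close> of v^4 cot \<theta> contains the cross term of
    the square. Since 1/sin^2 = cot^2 + 1, what remains besides g^2 and \<open>p\<close> is a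
    constant multiple of v^6.\<close>
  note P = primitive_on_mult[OF primitive_on_mult[OF p2 p2] pc]
  define p where "p = (\<lambda>x. cot (\<theta> x) * (v x * v x * (v x * g x + v x * g x) + v x * v x * (v x * g x + v x * g x)) +
     v x * v x * (v x * v x) * (- inverse ((sin (\<theta> x))\<^sup>2) * (k * (v x)\<^sup>2)))"
  have pI: "set_integrable lborel {a..b} p"
    using P unfolding primitive_on_def p_def by blast
  have pE: "(LINT x:{a..b}|lborel. p x) = v b ^ 4 * cot (\<theta> b) - v a ^ 4 * cot (\<theta> a)"
    using primitive_on_LINT[OF P, of a b] \<open>a \<le> b\<close> by (simp add: p_def eval_nat_numeral mult_ac)
  have v6: "set_integrable lborel {a..b} (\<lambda>x. v x ^ 6)"
    by (intro borel_integrable_atLeastAtMost' continuous_intros cv)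
  have eq: "(g x - k / 2 * cot (\<theta> x) * v x ^ 3)\<^sup>2 = (g x)\<^sup>2 - k / 4 * p x - k\<^sup>2 / 4 * v x ^ 6"
    if "x \<in> {a..b}" for x
  proof -
    have "(cot (\<theta> x))\<^sup>2 = inverse ((sin (\<theta> x))\<^sup>2) - 1"
      using snz[OF that] by (simp add: cot_def field_simps cos_squared_eq)
    then have "inverse ((sin (\<theta> x))\<^sup>2) = (cot (\<theta> x))\<^sup>2 + 1" by simp
    then show ?thesis unfolding p_def by (simp add: algebra_simps power2_eq_square eval_nat_numeral)
  qed
  have "0 \<le> (LINT x:{a..b}|lborel. (g x - k / 2 * cot (\<theta> x) * v x ^ 3)\<^sup>2)"
    unfolding set_lebesgue_integral_def by (intro integral_nonneg_AE AE_I2) auto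
  also have "\<dots> = (LINT x:{a..b}|lborel. (g x)\<^sup>2 - k / 4 * p x - k\<^sup>2 / 4 * v x ^ 6)"
    by (rule set_lebesgue_integral_cong) (use eq in auto)
  also have "\<dots> = (LINT x:{a..b}|lborel. (g x)\<^sup>2) - k / 4 * (LINT x:{a..b}|lborel. p x) - k\<^sup>2 / 4 * (LINT x:{a..b}|lborel. v x ^ 6)"
    using g2 pI v6 by (simp add: set_integral_diff)
  finally show ?thesis by (simp add: pE)
qed

lemma DERIV_affine_integral:
  assumes "continuous_on {a..b} v" "a \<le> x" "x \<le> b"
  shows "((\<lambda>x. \<alpha> + k * integral {a..x} (\<lambda>t. (v t)\<^sup>2)) has_real_derivative k * (v x)\<^sup>2) (at x within {a..b})"
proof -
  have "((\<lambda>x. integral {a..x} (\<lambda>t. (v t)\<^sup>2)) has_real_derivative (v x)\<^sup>2) (at x within {a..b})"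
    by (rule integral_has_real_derivative) (use assms in \<open>auto intro!: continuous_intros\<close>)
  from DERIV_add[OF DERIV_const[of \<alpha>] DERIV_cmult[OF this, of k]] show ?thesis by simp
qed

lemma integral_square_mono:
  fixes v :: "real \<Rightarrow> real"
  assumes "continuous_on {a..b} v" "a \<le> x" "x \<le> b"
  shows "0 \<le> integral {a..x} (\<lambda>t. (v t)\<^sup>2)"
    and "integral {a..x} (\<lambda>t. (v t)\<^sup>2) \<le> integral {a..b} (\<lambda>t. (v t)\<^sup>2)"
proof -
  have i: "(\<lambda>t. (v t)\<^sup>2) integrable_on {a..b}"
    using assms by (intro integrable_continuous_real continuous_intros)
  then have i': "(\<lambda>t. (v t)\<^sup>2) integrable_on {a..x}"
    using assms by (auto intro: integrable_subinterval_real)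
  from i' show "0 \<le> integral {a..x} (\<lambda>t. (v t)\<^sup>2)" by (rule integral_nonneg) auto
  show "integral {a..x} (\<lambda>t. (v t)\<^sup>2) \<le> integral {a..b} (\<lambda>t. (v t)\<^sup>2)"
    by (rule integral_subset_le) (use assms i i' in auto)
qed

lemma LINT_square_eq_integral:
  fixes v :: "real \<Rightarrow> real"
  assumes "continuous_on {a..b} v"
  shows "(LINT x:{a..b}|lborel. (v x)\<^sup>2) = integral {a..b} (\<lambda>t. (v t)\<^sup>2)"
  by (intro set_borel_integral_eq_integral(2) borel_integrable_atLeastAtMost' continuous_intros assms)

section \<open>Sextic inequalities on a bounded interval\<close>

text \<open>The angle equals pi/2, where the cotangent vanishes, at the free endpoint; at the other
  one \<open>v\<close> itself vanishes. Only a range of pi/2 is thus available, so \<open>k\<close>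
  is close to pi/2 over the mass.\<close>

lemma sextic_bound_vanishing_endpoint:
  assumes v: "primitive_on a b v g" and "a \<le> b"
    and g2: "set_integrable lborel {a..b} (\<lambda>x. (g x)\<^sup>2)"
    and zero: "v a = 0 \<or> v b = 0"
  shows "pi\<^sup>2 / 16 * (LINT x:{a..b}|lborel. v x ^ 6)
           \<le> (LINT x:{a..b}|lborel. (g x)\<^sup>2) * (LINT x:{a..b}|lborel. (v x)\<^sup>2)\<^sup>2"
proof -
  have cv: "continuous_on {a..b} v" by (rule primitive_on_continuous[OF v])
  define m where "m = integral {a..b} (\<lambda>t. (v t)\<^sup>2)"
  define D where "D = (LINT x:{a..b}|lborel. (g x)\<^sup>2)"
  define S where "S = (LINT x:{a..b}|lborel. v x ^ 6)"
  have m0: "m \<ge> 0" unfolding m_def using integral_square_mono(1)[OF cv, of b] \<open>a \<le> b\<close> by simp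
  have eps: "pi\<^sup>2 / 16 * S \<le> D * (m + \<epsilon>)\<^sup>2" if "\<epsilon> > 0" for \<epsilon>
  proof -
    \<comment> \<open>With \<epsilon> = 0 the angle would reach 0 or pi at the zero of
      \<open>v\<close>, where the sine is no longer positive, and \<open>k\<close> would degenerate
      for zero mass.\<close>
    define k where "k = pi / (2 * (m + \<epsilon>))"
    define \<alpha> where "\<alpha> = (if v a = 0 then pi / 2 - k * m else pi / 2)"
    define \<theta> where "\<theta> = (\<lambda>x. \<alpha> + k * integral {a..x} (\<lambda>t. (v t)\<^sup>2))"
    have k0: "k > 0" and km: "k * m < pi / 2"
      using that m0 pi_gt_zero by (auto simp: k_def field_simps)
    have sin0: "0 < sin (\<theta> x)" if x: "a \<le> x" "x \<le> b" for x
    proof (rule sin_gt_zero)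
      have "0 \<le> k * integral {a..x} (\<lambda>t. (v t)\<^sup>2)" "k * integral {a..x} (\<lambda>t. (v t)\<^sup>2) \<le> k * m"
        using k0 integral_square_mono[OF cv x] by (auto simp: m_def)
      then show "0 < \<theta> x" "\<theta> x < pi"
        using km pi_gt_zero by (auto simp: \<theta>_def \<alpha>_def)
    qed
    have "k\<^sup>2 / 4 * S + k / 4 * (v b ^ 4 * cot (\<theta> b) - v a ^ 4 * cot (\<theta> a)) \<le> D"
      unfolding S_def D_def
      by (rule cot_weighted_bound[OF v \<open>a \<le> b\<close> g2 _ sin0])
         (use DERIV_affine_integral[OF cv] in \<open>auto simp: \<theta>_def\<close>)
    moreover have "v b ^ 4 * cot (\<theta> b) = 0"
      using zero by (cases "v a = 0") (auto simp: \<theta>_def \<alpha>_def m_def[symmetric] cot_def)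
    moreover have "v a ^ 4 * cot (\<theta> a) = 0"
      by (cases "v a = 0") (auto simp: \<theta>_def \<alpha>_def cot_def)
    ultimately have "k\<^sup>2 / 4 * S \<le> D" by simp
    then have "k\<^sup>2 / 4 * S * (m + \<epsilon>)\<^sup>2 \<le> D * (m + \<epsilon>)\<^sup>2"
      by (rule mult_right_mono) simp
    also have "k\<^sup>2 / 4 * S * (m + \<epsilon>)\<^sup>2 = (k * (m + \<epsilon>))\<^sup>2 / 4 * S"
      by (simp add: power_mult_distrib)
    also have "k * (m + \<epsilon>) = pi / 2"
      using that m0 by (simp add: k_def field_simps)
    finally show ?thesis by (simp add: power_divide)
  qed
  have "((\<lambda>\<epsilon>. D * (m + \<epsilon>)\<^sup>2) \<longlongrightarrow> D * (m + 0)\<^sup>2) (at_right 0)"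
    by (intro tendsto_intros)
  then have "pi\<^sup>2 / 16 * S \<le> D * (m + 0)\<^sup>2"
    by (rule tendsto_lowerbound) (use eps in \<open>auto simp: eventually_at_right_less intro!: eventually_at_rightI[of 0 1]\<close>)
  then show ?thesis
    by (simp add: S_def D_def m_def LINT_square_eq_integral[OF cv])
qed

text \<open>Meant for truncations of a function on the line, whose endpoint values are small but not
  zero. The angle runs symmetrically from \<open>k * \<epsilon>\<close> to
  \<open>pi - k * \<epsilon>\<close>, so both boundary terms carry
  \<open>k * cot (k * \<epsilon>)\<close>, which is at most 1/\<epsilon> whatever the mass.\<close>

lemma sextic_bound_small_endpoints:
  assumes v: "primitive_on a b v g" and "a \<le> b" and \<epsilon>: "\<epsilon> > 0"
    and g2: "set_integrable lborel {a..b} (\<lambda>x. (g x)\<^sup>2)"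
  shows "pi\<^sup>2 / 4 * (LINT x:{a..b}|lborel. v x ^ 6)
           \<le> ((LINT x:{a..b}|lborel. (g x)\<^sup>2) + (v a ^ 4 + v b ^ 4) / (4 * \<epsilon>))
               * ((LINT x:{a..b}|lborel. (v x)\<^sup>2) + 2 * \<epsilon>)\<^sup>2"
proof -
  have cv: "continuous_on {a..b} v" by (rule primitive_on_continuous[OF v])
  define m where "m = integral {a..b} (\<lambda>t. (v t)\<^sup>2)"
  define D where "D = (LINT x:{a..b}|lborel. (g x)\<^sup>2)"
  define S where "S = (LINT x:{a..b}|lborel. v x ^ 6)"
  define k where "k = pi / (m + 2 * \<epsilon>)"
  define \<theta> where "\<theta> = (\<lambda>x. k * \<epsilon> + k * integral {a..x} (\<lambda>t. (v t)\<^sup>2))"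
  have m0: "m \<ge> 0" unfolding m_def using integral_square_mono(1)[OF cv, of b] \<open>a \<le> b\<close> by simp
  have k0: "k > 0" and ke: "k * \<epsilon> \<le> pi / 2"
    using \<epsilon> m0 pi_gt_zero by (auto simp: k_def field_simps)
  have "k * (m + 2 * \<epsilon>) = pi" using \<epsilon> m0 by (simp add: k_def)
  then have km: "k * \<epsilon> + k * m = pi - k * \<epsilon>" by (simp add: algebra_simps)
  have ke0: "0 < k * \<epsilon>" using k0 \<epsilon> by simp
  have sin0: "0 < sin (\<theta> x)" if x: "a \<le> x" "x \<le> b" for x
  proof (rule sin_gt_zero)
    have "0 \<le> k * integral {a..x} (\<lambda>t. (v t)\<^sup>2)" "k * integral {a..x} (\<lambda>t. (v t)\<^sup>2) \<le> k * m"
      using k0 integral_square_mono[OF cv x] by (auto simp: m_def)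
    then show "0 < \<theta> x" "\<theta> x < pi"
      using km ke0 unfolding \<theta>_def by linarith+
  qed
  have main: "k\<^sup>2 / 4 * S + k / 4 * (v b ^ 4 * cot (\<theta> b) - v a ^ 4 * cot (\<theta> a)) \<le> D"
    unfolding S_def D_def
    by (rule cot_weighted_bound[OF v \<open>a \<le> b\<close> g2 _ sin0])
       (use DERIV_affine_integral[OF cv] in \<open>auto simp: \<theta>_def\<close>)
  have ta: "\<theta> a = k * \<epsilon>" by (simp add: \<theta>_def)
  have "\<theta> b = pi - k * \<epsilon>" using km by (simp add: \<theta>_def m_def)
  then have tb: "cot (\<theta> b) = - cot (k * \<epsilon>)" by (simp add: cot_def)
  \<comment> \<open>This is y \<le> tan y divided by tan y. The angle pi/2, a pole of tan, occurs
    exactly when m = 0 and is treated apart.\<close>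
  have "k * \<epsilon> * cot (k * \<epsilon>) \<le> 1"
  proof (cases "k * \<epsilon> = pi / 2")
    case True
    then have "cot (k * \<epsilon>) = 0" unfolding cot_def True by simp
    then show ?thesis by simp
  next
    case False
    then have lt: "k * \<epsilon> < pi / 2" using ke by simp
    then have "k * \<epsilon> \<le> tan (k * \<epsilon>)"
      using abs_tan_ge[of "k * \<epsilon>"] ke0 tan_gt_zero[OF ke0 lt] by linarith
    then have "k * \<epsilon> * cot (k * \<epsilon>) \<le> tan (k * \<epsilon>) * cot (k * \<epsilon>)"
      using ke0 lt cot_gt_zero[OF ke0 lt] by (intro mult_right_mono) auto
    also have "\<dots> = 1"
      using ke0 lt tan_gt_zero[OF ke0 lt] by (simp add: cot_altdef)
    finally show ?thesis .
  qed
  then have kc: "k * cot (k * \<epsilon>) \<le> 1 / \<epsilon>"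
    using \<epsilon> by (simp add: field_simps)
  have "k\<^sup>2 / 4 * S \<le> D + (v a ^ 4 + v b ^ 4) / 4 * (k * cot (k * \<epsilon>))"
    using main by (simp add: ta tb field_simps)
  also have "\<dots> \<le> D + (v a ^ 4 + v b ^ 4) / 4 * (1 / \<epsilon>)"
    by (intro add_left_mono mult_left_mono kc) simp
  finally have "k\<^sup>2 / 4 * S \<le> D + (v a ^ 4 + v b ^ 4) / (4 * \<epsilon>)" by simp
  then have "k\<^sup>2 / 4 * S * (m + 2 * \<epsilon>)\<^sup>2 \<le> (D + (v a ^ 4 + v b ^ 4) / (4 * \<epsilon>)) * (m + 2 * \<epsilon>)\<^sup>2"
    by (rule mult_right_mono) simp
  also have "k\<^sup>2 / 4 * S * (m + 2 * \<epsilon>)\<^sup>2 = pi\<^sup>2 / 4 * S"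
    using \<epsilon> m0 by (simp add: k_def power_divide)
  finally show ?thesis
    by (simp add: S_def D_def m_def LINT_square_eq_integral[OF cv])
qed

section \<open>Smooth bump functions\<close>

text \<open>Derivatives are existential witnesses rather than iterates of \<open>deriv\<close>, so
  that closure under sums, products and affine substitutions is a plain induction; the
  \<open>deriv\<close> form demanded by \<open>test_fun\<close> is recovered afterwards.\<close>

fun diff_times :: "nat \<Rightarrow> (real \<Rightarrow> real) \<Rightarrow> bool" where
  "diff_times 0 f \<longleftrightarrow> True"
| "diff_times (Suc n) f \<longleftrightarrow> (\<exists>f'. (\<forall>x. (f has_real_derivative f' x) (at x)) \<and> diff_times n f')"

lemma diff_times_imp_differentiable:
  "diff_times (Suc k) f \<Longrightarrow> (deriv ^^ k) f differentiable (at x)"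
proof (induction k arbitrary: f)
  case 0
  then show ?case by (auto simp: real_differentiable_def)
next
  case (Suc k)
  then obtain f' where f': "\<And>x. (f has_real_derivative f' x) (at x)" "diff_times (Suc k) f'"
    by (metis diff_times.simps(2))
  have "deriv f = f'" using f' DERIV_imp_deriv by blast
  then show ?case using Suc.IH[OF f'(2)] by (simp add: funpow_Suc_right del: funpow.simps)
qed

lemma diff_times_pred: "diff_times (Suc n) f \<Longrightarrow> diff_times n f"
  by (induction n arbitrary: f) auto

lemma diff_times_add: "diff_times n f \<Longrightarrow> diff_times n g \<Longrightarrow> diff_times n (\<lambda>x. f x + g x)"
proof (induction n arbitrary: f g)
  case (Suc n)
  then obtain f' g' where
    "\<And>x. (f has_real_derivative f' x) (at x)" "diff_times n f'"
    "\<And>x. (g has_real_derivative g' x) (at x)" "diff_times n g'"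
    by auto
  then show ?case
    using Suc.IH[of f' g'] by (auto intro!: exI[of _ "\<lambda>x. f' x + g' x"] derivative_eq_intros)
qed simp

lemma diff_times_cmult: "diff_times n f \<Longrightarrow> diff_times n (\<lambda>x. c * f x)"
proof (induction n arbitrary: f)
  case (Suc n)
  then obtain f' where "\<And>x. (f has_real_derivative f' x) (at x)" "diff_times n f'" by auto
  then show ?case
    using Suc.IH[of f'] by (auto intro!: exI[of _ "\<lambda>x. c * f' x"] DERIV_cmult)
qed simp

lemma diff_times_mult: "diff_times n f \<Longrightarrow> diff_times n g \<Longrightarrow> diff_times n (\<lambda>x. f x * g x)"
proof (induction n arbitrary: f g)
  case (Suc n)
  then obtain f' g' where
    d: "\<And>x. (f has_real_derivative f' x) (at x)" "diff_times n f'"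
    "\<And>x. (g has_real_derivative g' x) (at x)" "diff_times n g'"
    by auto
  have "diff_times n (\<lambda>x. f' x * g x + g' x * f x)"
    using Suc.IH[of f' g] Suc.IH[of g' f] d Suc.prems diff_times_pred by (intro diff_times_add) blast+
  then show ?case
    using d(1,3) by (auto intro!: exI[of _ "\<lambda>x. f' x * g x + g' x * f x"] DERIV_mult)
qed simp

lemma diff_times_affine: "diff_times n f \<Longrightarrow> diff_times n (\<lambda>x. f (c * x + d))"
proof (induction n arbitrary: f)
  case (Suc n)
  then obtain f' where f': "\<And>x. (f has_real_derivative f' x) (at x)" "diff_times n f'" by auto
  have "((\<lambda>x. f (c * x + d)) has_real_derivative c * f' (c * x + d)) (at x)" for x
  proof -
    have "((\<lambda>x. c * x + d) has_real_derivative c) (at x)"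
      by (auto intro!: derivative_eq_intros)
    from DERIV_chain2[OF f'(1) this] show ?thesis by (simp add: mult.commute)
  qed
  with diff_times_cmult[OF Suc.IH[OF f'(2)], of c] show ?case
    by (auto intro!: exI[of _ "\<lambda>x. c * f' (c * x + d)"])
qed simp

text \<open>The class of functions p(1/x) exp(-1/x), extended by 0, is closed under differentiation.\<close>

definition flat :: "real poly \<Rightarrow> real \<Rightarrow> real" where
  "flat p x = (if x > 0 then poly p (1 / x) * exp (- 1 / x) else 0)"

text \<open>The free exponent k carries the induction: splitting off the constant coefficient leaves
  the tail multiplied by one more t.\<close>

lemma power_poly_exp_tendsto_0:
  "((\<lambda>t::real. t ^ k * poly p t * exp (- t)) \<longlongrightarrow> 0) at_top"
proof (induction p arbitrary: k)
  case (pCons c p)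
  have "((\<lambda>t::real. c * (t ^ k / exp t) + t ^ Suc k * poly p t * exp (- t)) \<longlongrightarrow> c * 0 + 0) at_top"
    by (intro tendsto_intros tendsto_power_div_exp_0 pCons.IH)
  then show ?case by (simp add: exp_minus field_simps)
qed simp

text \<open>With t = 1/x one has dt/dx = - t^2, so p(t) exp(-t) has x-derivative t^2 (p - p')(t)
  exp(-t); this is the polynomial in the statement. At 0 the right difference quotient is t p(t)
  exp(-t) for t tending to infinity.\<close>

lemma DERIV_flat: "(flat p has_real_derivative flat ([:0, 0, 1:] * (p - pderiv p)) x) (at x)"
proof -
  consider "x > 0" | "x < 0" | "x = 0" by linarith
  then show ?thesis
  proof cases
    case 1
    have "((\<lambda>x. poly p (1 / x) * exp (- 1 / x)) has_real_derivative
        (poly (pderiv p) (1 / x) * (- 1 / x\<^sup>2)) * exp (- 1 / x) + (exp (- 1 / x) * (1 / x\<^sup>2)) * poly p (1 / x)) (at x)"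
    proof (rule DERIV_mult)
      have "((\<lambda>x. 1 / x) has_real_derivative - 1 / x\<^sup>2) (at x)"
        using 1 by (auto intro!: derivative_eq_intros simp: power2_eq_square)
      from DERIV_chain2[OF poly_DERIV this]
      show "((\<lambda>x. poly p (1 / x)) has_real_derivative poly (pderiv p) (1 / x) * (- 1 / x\<^sup>2)) (at x)" .
      show "((\<lambda>x. exp (- 1 / x)) has_real_derivative exp (- 1 / x) * (1 / x\<^sup>2)) (at x)"
        using 1 by (auto intro!: derivative_eq_intros simp: power2_eq_square)
    qed
    moreover have "(poly (pderiv p) (1 / x) * (- 1 / x\<^sup>2)) * exp (- 1 / x) + (exp (- 1 / x) * (1 / x\<^sup>2)) * poly p (1 / x)
       = flat ([:0, 0, 1:] * (p - pderiv p)) x"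
      using 1 by (simp add: flat_def field_simps power2_eq_square)
    ultimately have "((\<lambda>x. poly p (1 / x) * exp (- 1 / x)) has_real_derivative flat ([:0, 0, 1:] * (p - pderiv p)) x) (at x)"
      by simp
    then show ?thesis
      by (rule has_field_derivative_transform_within_open[where S = "{0<..}"]) (use 1 in \<open>auto simp: flat_def\<close>)
  next
    case 2
    have "((\<lambda>x. 0) has_real_derivative flat ([:0, 0, 1:] * (p - pderiv p)) x) (at x)"
      using 2 by (simp add: flat_def)
    then show ?thesis
      by (rule has_field_derivative_transform_within_open[where S = "{..<0}"]) (use 2 in \<open>auto simp: flat_def\<close>)
  next
    case 3
    have r: "((\<lambda>h. flat p h / h) \<longlongrightarrow> 0) (at_right 0)"
    proof (subst filterlim_at_right_to_top)
      have "eventually (\<lambda>t::real. flat p (inverse t) / inverse t = t ^ 1 * poly p t * exp (- t)) at_top"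
        using eventually_gt_at_top[of 0] by eventually_elim (simp add: flat_def field_simps)
      then show "((\<lambda>t. flat p (inverse t) / inverse t) \<longlongrightarrow> 0) at_top"
        using power_poly_exp_tendsto_0[of 1 p] by (simp add: tendsto_cong)
    qed
    have l: "((\<lambda>h. flat p h / h) \<longlongrightarrow> 0) (at_left 0)"
    proof (rule tendsto_eventually)
      show "eventually (\<lambda>h. flat p h / h = 0) (at_left 0)"
        by (rule eventually_at_leftI[of "-1"]) (auto simp: flat_def)
    qed
    have "((\<lambda>h. flat p h / h) \<longlongrightarrow> 0) (at 0)"
      using l r by (rule filterlim_split_at)
    then show ?thesis using 3 by (simp add: DERIV_def flat_def)
  qed
qed

lemma diff_times_flat: "diff_times n (flat p)"
  by (induction n arbitrary: p) (auto intro!: DERIV_flat exI)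

text \<open>The parameter r sharpens the bump without moving its support: exp(-1/(r y)) tends to 1
  for each y > 0. Hence smooth functions bounded by 1 approximate the indicator of the open
  interval.\<close>

definition bump :: "real \<Rightarrow> real \<Rightarrow> real \<Rightarrow> real \<Rightarrow> real" where
  "bump a b r x = flat 1 (r * (x - a)) * flat 1 (r * (b - x))"

lemma diff_times_bump: "diff_times n (bump a b r)"
proof -
  have "diff_times n (\<lambda>x. flat 1 (r * x + (- r * a)) * flat 1 ((- r) * x + r * b))"
    by (intro diff_times_mult diff_times_affine diff_times_flat)
  moreover have "(\<lambda>x. flat 1 (r * x + (- r * a)) * flat 1 ((- r) * x + r * b)) = bump a b r"
    by (auto simp: bump_def algebra_simps)
  ultimately show ?thesis by simp
qed

lemma continuous_on_bump: "continuous_on S (bump a b r)"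
proof -
  obtain f' where "\<And>x. (bump a b r has_real_derivative f' x) (at x)"
    using diff_times_bump[of "Suc 0" a b r] by auto
  then show ?thesis
    by (meson DERIV_isCont continuous_at_imp_continuous_on)
qed

lemma bump_eq_0: "r > 0 \<Longrightarrow> x \<notin> {a<..<b} \<Longrightarrow> bump a b r x = 0"
  by (auto simp: bump_def flat_def zero_less_mult_iff)

lemma bump_pos: "r > 0 \<Longrightarrow> x \<in> {a<..<b} \<Longrightarrow> bump a b r x > 0"
  by (auto simp: bump_def flat_def)

lemma bump_bounds: "0 \<le> bump a b r x" "bump a b r x \<le> 1"
proof -
  have *: "0 \<le> flat 1 y" "flat 1 y \<le> 1" for y by (auto simp: flat_def)
  show "0 \<le> bump a b r x" "bump a b r x \<le> 1"
    unfolding bump_def using * by (auto intro: mult_le_one)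
qed

lemma bump_tendsto_indicator:
  "(\<lambda>n. bump a b (real (Suc n)) x) \<longlonglongrightarrow> indicator {a<..<b} x"
proof (cases "x \<in> {a<..<b}")
  case True
  have *: "(\<lambda>n. flat 1 (real (Suc n) * y)) \<longlonglongrightarrow> 1" if "y > 0" for y
  proof -
    have "(\<lambda>n. exp (- (inverse (real (Suc n)) * (1 / y)))) \<longlonglongrightarrow> exp (- (0 * (1 / y)))"
      by (intro tendsto_intros LIMSEQ_inverse_real_of_nat)
    then show ?thesis using that by (simp add: flat_def field_simps del: of_nat_Suc)
  qed
  have "(\<lambda>n. bump a b (real (Suc n)) x) \<longlonglongrightarrow> 1 * 1"
    unfolding bump_def using True by (intro tendsto_mult *) auto
  then show ?thesis using True by simp
next
  case False
  then show ?thesis by (simp add: bump_eq_0 del: of_nat_Suc)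
qed

section \<open>Weak derivatives\<close>

lemma set_integrable_Ioo_iff_Icc:
  fixes f :: "real \<Rightarrow> real"
  shows "set_integrable lborel {a<..<b} f \<longleftrightarrow> set_integrable lborel {a..b} f"
  by (rule set_integrable_discrete_difference[where X = "{a, b}"]) auto

lemma LINT_Ioo_eq_Icc:
  fixes f :: "real \<Rightarrow> real"
  shows "(LINT x:{a<..<b}|lborel. f x) = (LINT x:{a..b}|lborel. f x)"
  by (rule set_integral_discrete_difference[where X = "{a, b}"]) auto

lemma test_fun_DERIV:
  assumes "test_fun U \<phi>" shows "(\<phi> has_real_derivative deriv \<phi> x) (at x)"
proof -
  have "(deriv ^^ 0) \<phi> differentiable (at x)" using assms unfolding test_fun_def by blast
  then show ?thesis by (simp add: DERIV_deriv_iff_real_differentiable)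
qed

lemma test_fun_continuous_deriv:
  assumes "test_fun U \<phi>" shows "continuous_on S (deriv \<phi>)"
proof -
  have "deriv \<phi> differentiable (at x)" for x
  proof -
    have "(deriv ^^ 1) \<phi> differentiable (at x)" using assms unfolding test_fun_def by blast
    then show ?thesis by simp
  qed
  then show ?thesis
    by (meson continuous_at_imp_continuous_on differentiable_imp_continuous_within)
qed

lemma test_fun_zero:
  assumes "test_fun U \<phi>" "x \<notin> U" shows "\<phi> x = 0"
proof (rule ccontr)
  assume "\<phi> x \<noteq> 0"
  then have "x \<in> closure {x. \<phi> x \<noteq> 0}" using closure_subset[of "{x. \<phi> x \<noteq> 0}"] by auto
  with assms show False unfolding test_fun_def by auto
qed

lemma test_fun_subset: "test_fun U \<phi> \<Longrightarrow> U \<subseteq> V \<Longrightarrow> test_fun V \<phi>"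
  unfolding test_fun_def by blast

lemma primitive_on_test_fun: "test_fun U \<phi> \<Longrightarrow> primitive_on a b \<phi> (deriv \<phi>)"
  by (rule primitive_on_C1) (erule has_field_derivative_at_within[OF test_fun_DERIV], erule test_fun_continuous_deriv)

lemma primitive_on_imp_weak_deriv:
  assumes h: "primitive_on a b h g" and "a \<le> b"
  shows "weak_deriv_on {a<..<b} h g"
  unfolding weak_deriv_on_def
proof (intro allI impI)
  fix \<phi> assume t: "test_fun {a<..<b} \<phi>"
  have p: "primitive_on a b \<phi> (deriv \<phi>)" by (rule primitive_on_test_fun[OF t])
  have z: "\<phi> a = 0" "\<phi> b = 0" using test_fun_zero[OF t] by auto
  have i1: "set_integrable lborel {a..b} (\<lambda>x. \<phi> x * g x)"
    using h by (intro set_integrable_continuous_mult primitive_on_continuous[OF p]) (simp only: primitive_on_def)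
  have i2: "set_integrable lborel {a..b} (\<lambda>x. h x * deriv \<phi> x)"
    using p by (intro set_integrable_continuous_mult primitive_on_continuous[OF h]) (simp only: primitive_on_def)
  have "(LINT x:{a..b}|lborel. \<phi> x * g x + h x * deriv \<phi> x) = 0"
    using primitive_on_by_parts[OF h p \<open>a \<le> b\<close>] z by simp
  then have "(LINT x:{a..b}|lborel. \<phi> x * g x) + (LINT x:{a..b}|lborel. h x * deriv \<phi> x) = 0"
    using i1 i2 by simp
  then show "(LINT x:{a<..<b}|lborel. h x * deriv \<phi> x) = - (LINT x:{a<..<b}|lborel. g x * \<phi> x)"
    by (simp add: LINT_Ioo_eq_Icc mult.commute)
qed

text \<open>The primitive starting at a vanishes left of a because f does, and right of b because
  the total integral of f is zero; so its support stays in [a,b].\<close>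

lemma test_fun_primitive:
  assumes sm: "\<And>n. diff_times n f" and z: "\<And>x. x \<notin> {a..b} \<Longrightarrow> f x = 0" and "a \<le> b"
    and I0: "(LINT x:{a..b}|lborel. f x) = 0" and U: "{a..b} \<subseteq> U"
  obtains \<phi> where "test_fun U \<phi>" "deriv \<phi> = f"
proof -
  define \<phi> where "\<phi> = (\<lambda>x::real. LBINT y=a..x. f y)"
  obtain f' where "\<And>x. (f has_real_derivative f' x) (at x)"
    using sm[of "Suc 0"] by auto
  then have cf: "continuous_on S f" for S
    by (meson DERIV_isCont continuous_at_imp_continuous_on)
  have d: "(\<phi> has_real_derivative f x) (at x)" for x
  proof -
    \<comment> \<open>An interval with both a and x in its interior makes the fundamental theorem
      applicable on either side of a.\<close>
    have "(\<phi> has_vector_derivative f x) (at x within {min a x - 1..max a x + 1})"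
      unfolding \<phi>_def by (rule interval_integral_FTC2) (auto intro: cf)
    then have "(\<phi> has_vector_derivative f x) (at x within {min a x - 1<..<max a x + 1})"
      by (rule has_vector_derivative_within_subset) auto
    then show ?thesis
      by (subst (asm) has_vector_derivative_within_open)
         (auto simp: has_real_derivative_iff_has_vector_derivative)
  qed
  have df: "deriv \<phi> = f" using d DERIV_imp_deriv by blast
  have zero: "\<phi> x = 0" if "x \<notin> {a..b}" for x
  proof (cases "x < a")
    case True
    have "\<phi> x = - (LBINT y=x..a. f y)"
      unfolding \<phi>_def by (rule interval_integral_endpoints_reverse)
    also have "(LBINT y=x..a. f y) = (LINT y:{x<..<a}|lborel. f y)"
      using True by (simp add: interval_integral_Ioo)
    also have "\<dots> = (LINT y:{x<..<a}|lborel. 0)"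
      by (rule set_lebesgue_integral_cong) (auto simp: z)
    finally show ?thesis by simp
  next
    case False
    with that have x: "b < x" by auto
    have "\<phi> x = (LINT y:{a..x}|lborel. f y)"
      unfolding \<phi>_def using x \<open>a \<le> b\<close> by (simp add: interval_integral_Icc)
    also have "\<dots> = (LINT y:{a..b}|lborel. f y)"
      unfolding set_lebesgue_integral_def
      by (rule Bochner_Integration.integral_cong) (use x z in \<open>auto simp: indicator_def\<close>)
    finally show ?thesis using I0 by simp
  qed
  have "closure {x. \<phi> x \<noteq> 0} \<subseteq> {a..b}"
  proof (rule closure_minimal)
    show "{x. \<phi> x \<noteq> 0} \<subseteq> {a..b}" using zero by blast
  qed simp
  moreover from this have "compact (closure {x. \<phi> x \<noteq> 0})"
    by (meson bounded_closed_interval bounded_subset closed_closure compact_eq_bounded_closed)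
  moreover have "(deriv ^^ k) \<phi> differentiable (at x)" for k x
  proof (rule diff_times_imp_differentiable)
    show "diff_times (Suc k) \<phi>" unfolding diff_times.simps using d sm by blast
  qed
  ultimately have "test_fun U \<phi>" unfolding test_fun_def using U by blast
  then show thesis using df that by blast
qed

section \<open>Functions with zero weak derivative and absolutely continuous representatives\<close>

text \<open>Lebesgue differentiation: off a negligible set F x is the limit of averages over
  [x, x + h], all of which vanish. The exceptional set is null for the completed measure, so the
  conclusion is drawn there and then transferred to \<open>lborel\<close>.\<close>

lemma AE_zero_if_integrals_zero:
  fixes F :: "real \<Rightarrow> real"
  assumes F: "set_integrable lborel {a..b} F"
    and z: "\<And>x y. a < x \<Longrightarrow> x < y \<Longrightarrow> y < b \<Longrightarrow> (LINT t:{x..y}|lborel. F t) = 0"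
  shows "AE x in lborel. x \<in> {a<..<b} \<longrightarrow> F x = 0"
proof -
  define G where "G = (\<lambda>x. indicator {a..b} x *\<^sub>R F x)"
  have G: "integrable lborel G" using F unfolding G_def set_integrable_def .
  have "G integrable_on UNIV"
    using has_integral_integral_lborel[OF G] by blast
  then have "\<And>c d. G integrable_on cbox c d"
    using integrable_on_subcbox by blast
  then obtain N where N: "negligible N"
    "\<And>x e. \<lbrakk>x \<notin> N; 0 < e\<rbrakk> \<Longrightarrow> \<exists>d>0. \<forall>h. 0 < h \<and> h < d \<longrightarrow>
        norm (integral (cbox x (x + h *\<^sub>R One)) G /\<^sub>R h ^ DIM(real) - G x) < e"
    using integrable_ccontinuous_explicit[of G] by blast
  have "F x = 0" if x: "x \<notin> N" "x \<in> {a<..<b}" for x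
  proof (rule ccontr)
    assume "F x \<noteq> 0"
    then obtain d where d: "d > 0" "\<And>h. 0 < h \<Longrightarrow> h < d \<Longrightarrow>
        norm (integral {x..x + h} G / h - G x) < \<bar>F x\<bar>"
      using N(2)[OF x(1), of "\<bar>F x\<bar>"] by (auto simp: divide_inverse mult.commute)
    define h where "h = min (d / 2) ((b - x) / 2)"
    have h: "0 < h" "h < d" "x + h < b" using d x by (auto simp: h_def min_def field_simps)
    have "integral {x..x + h} G = integral {x..x + h} F"
      by (rule integral_cong) (use h x in \<open>auto simp: G_def\<close>)
    also have "\<dots> = (LINT t:{x..x + h}|lborel. F t)"
      by (rule set_borel_integral_eq_integral(2)[symmetric], rule set_integrable_subset[OF F])
         (use h x in auto)
    also have "\<dots> = 0" using h x by (intro z) auto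
    finally have "norm (0 / h - G x) < \<bar>F x\<bar>" using d(2)[OF h(1,2)] by simp
    then show False using x by (simp add: G_def)
  qed
  moreover have "AE x in lebesgue. x \<notin> N"
    using N(1) by (intro AE_not_in) (simp add: negligible_iff_null_sets)
  ultimately have "AE x in lebesgue. x \<in> {a<..<b} \<longrightarrow> F x = 0" by (auto elim: eventually_mono)
  then show ?thesis by (simp add: AE_completion_iff)
qed

text \<open>A smooth function supported inside the interval is the derivative of a test function
  once its integral is zero. Subtracting from each bump the right multiple of one fixed bump \<rho>
  achieves this, so w and the constant c have equal integrals against all bumps; sharpening the
  bumps gives equal integrals over all inner subintervals.\<close>

lemma du_Bois_Reymond:
  assumes w: "set_integrable lborel {A..B} w" and "A < B"
    and orth: "\<And>\<phi>. test_fun {A<..<B} \<phi> \<Longrightarrow> (LINT x:{A<..<B}|lborel. w x * deriv \<phi> x) = 0"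
  shows "\<exists>c. AE x in lborel. x \<in> {A<..<B} \<longrightarrow> w x = c"
proof -
  \<comment> \<open>The middle third is one possible choice: \<rho> must be supported strictly
    inside (A, B).\<close>
  define P Q where "P = A + (B - A) / 3" and "Q = B - (B - A) / 3"
  have PQ: "A < P" "P < Q" "Q < B" using \<open>A < B\<close> by (auto simp: P_def Q_def field_simps)
  define \<rho> where "\<rho> = bump P Q 1"
  define R where "R = (LINT x:{A..B}|lborel. \<rho> x)"
  define c where "c = (LINT x:{A..B}|lborel. \<rho> x * w x) / R"
  have si: "set_integrable lborel {A..B} (bump a b r)" for a b r
    by (intro borel_integrable_atLeastAtMost' continuous_on_bump)
  have siw: "set_integrable lborel {A..B} (\<lambda>x. bump a b r x * w x)" for a b r
    by (intro set_integrable_continuous_mult continuous_on_bump w)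
  have R0: "R > 0"
  proof -
    have "R = integral {A..B} \<rho>" unfolding R_def \<rho>_def
      by (rule set_borel_integral_eq_integral(2)[OF si])
    moreover have "integral {A..B} \<rho> \<noteq> 0"
    proof
      assume "integral {A..B} \<rho> = 0"
      then have "\<forall>x\<in>{A..B}. \<rho> x = 0"
        using \<open>A < B\<close> integral_eq_0_iff[of A B \<rho>] continuous_on_bump bump_bounds(1)
        unfolding \<rho>_def by blast
      moreover have "\<rho> ((P + Q) / 2) > 0" unfolding \<rho>_def using PQ by (intro bump_pos) auto
      ultimately show False using PQ by (auto simp: Ball_def)
    qed
    moreover have "R \<ge> 0" unfolding R_def \<rho>_def set_lebesgue_integral_def
      by (intro integral_nonneg_AE AE_I2) (auto simp: bump_bounds)
    ultimately show ?thesis by simp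
  qed
  have key: "(LINT x:{A..B}|lborel. bump a b r x * w x) = c * (LINT x:{A..B}|lborel. bump a b r x)"
    if ab: "A < a" "a < b" "b < B" and r: "r > 0" for a b r
  proof -
    define J where "J = (LINT x:{A..B}|lborel. bump a b r x)"
    \<comment> \<open>The coefficient is chosen so that the integral of \<open>f\<close>
      vanishes.\<close>
    define f where "f = (\<lambda>x. bump a b r x + (- J / R) * \<rho> x)"
    define a' b' where "a' = min a P" and "b' = max b Q"
    have ab': "A < a'" "a' < b'" "b' < B" using ab PQ by (auto simp: a'_def b'_def)
    have z: "f x = 0" if "x \<notin> {a'..b'}" for x
    proof -
      have "x \<notin> {a<..<b}" "x \<notin> {P<..<Q}" using that by (auto simp: a'_def b'_def)
      then show ?thesis using r by (simp add: f_def \<rho>_def bump_eq_0)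
    qed
    have fAB: "(LINT x:{A..B}|lborel. f x) = 0"
      unfolding f_def using si[of a b r] si[of P Q 1] R0 by (simp add: \<rho>_def J_def R_def)
    also have "(LINT x:{A..B}|lborel. f x) = (LINT x:{a'..b'}|lborel. f x)"
      unfolding set_lebesgue_integral_def
      by (rule Bochner_Integration.integral_cong) (use ab' z in \<open>auto simp: indicator_def\<close>)
    finally have I0: "(LINT x:{a'..b'}|lborel. f x) = 0" .
    have sm: "diff_times n f" for n
      unfolding f_def \<rho>_def by (intro diff_times_add diff_times_cmult diff_times_bump)
    obtain \<phi> where \<phi>: "test_fun {A<..<B} \<phi>" "deriv \<phi> = f"
      by (rule test_fun_primitive[OF sm z _ I0, of "{A<..<B}"]) (use ab' in auto)
    from orth[OF \<phi>(1)] have "0 = (LINT x:{A..B}|lborel. w x * f x)"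
      by (simp add: \<phi>(2) LINT_Ioo_eq_Icc)
    also have "\<dots> = (LINT x:{A..B}|lborel. bump a b r x * w x + (- J / R) * (\<rho> x * w x))"
      by (simp add: f_def algebra_simps)
    also have "\<dots> = (LINT x:{A..B}|lborel. bump a b r x * w x) - J * c"
      using siw[of a b r] siw[of P Q 1] by (simp add: \<rho>_def c_def)
    finally show ?thesis by (simp add: J_def mult.commute)
  qed
  \<comment> \<open>Dominated convergence, stated for a general integrand because it is needed both
    for \<open>w\<close> and for the constant 1.\<close>
  have lim: "(\<lambda>n. LINT x:{A..B}|lborel. bump a b (real (Suc n)) x * f x) \<longlonglongrightarrow> (LINT x:{a..b}|lborel. f x)"
    if ab: "A < a" "a < b" "b < B" and f: "set_integrable lborel {A..B} f" for a b f
  proof -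
    have fi: "integrable lborel (\<lambda>x. indicator {A..B} x *\<^sub>R f x)"
      using f unfolding set_integrable_def .
    have fm: "(\<lambda>x. indicator {A..B} x *\<^sub>R f x) \<in> borel_measurable lborel" using fi by auto
    have bm: "bump a b r \<in> borel_measurable lborel" for r
      using borel_measurable_continuous_onI[OF continuous_on_bump[of UNIV]] by simp
    have "(\<lambda>n. \<integral>x. bump a b (real (Suc n)) x * (indicator {A..B} x *\<^sub>R f x) \<partial>lborel)
       \<longlonglongrightarrow> (\<integral>x. indicator {a<..<b} x * (indicator {A..B} x *\<^sub>R f x) \<partial>lborel)"
    proof (rule integral_dominated_convergence[where w = "\<lambda>x. norm (indicator {A..B} x *\<^sub>R f x)"])
      show "integrable lborel (\<lambda>x. norm (indicator {A..B} x *\<^sub>R f x))"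
        using fi by (rule integrable_norm)
      show "AE x in lborel. (\<lambda>n. bump a b (real (Suc n)) x * (indicator {A..B} x *\<^sub>R f x))
          \<longlonglongrightarrow> indicator {a<..<b} x * (indicator {A..B} x *\<^sub>R f x)"
        by (intro AE_I2 tendsto_mult_right bump_tendsto_indicator)
      show "AE x in lborel. norm (bump a b (real (Suc n)) x * (indicator {A..B} x *\<^sub>R f x))
          \<le> norm (indicator {A..B} x *\<^sub>R f x)" for n
        by (intro AE_I2) (auto simp: abs_mult bump_bounds intro!: mult_left_le_one_le)
    qed (use fm bm in measurable)
    moreover have "(\<integral>x. indicator {a<..<b} x * (indicator {A..B} x *\<^sub>R f x) \<partial>lborel) = (LINT x:{a<..<b}|lborel. f x)"
      unfolding set_lebesgue_integral_def
      by (rule Bochner_Integration.integral_cong) (use ab in \<open>auto simp: indicator_def\<close>)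
    moreover have "(\<integral>x. bump a b r x * (indicator {A..B} x *\<^sub>R f x) \<partial>lborel) = (LINT x:{A..B}|lborel. bump a b r x * f x)" for r
      unfolding set_lebesgue_integral_def by (simp add: mult_ac)
    ultimately show ?thesis by (simp add: LINT_Ioo_eq_Icc)
  qed
  have c1: "set_integrable lborel {A..B} (\<lambda>x. c)" "set_integrable lborel {A..B} (\<lambda>x. 1::real)"
    by (auto intro!: borel_integrable_atLeastAtMost' continuous_intros)
  have "AE x in lborel. x \<in> {A<..<B} \<longrightarrow> w x - c = 0"
  proof (rule AE_zero_if_integrals_zero)
    show "set_integrable lborel {A..B} (\<lambda>x. w x - c)" using w c1 by simp
    fix a b assume ab: "A < a" "a < b" "b < B"
    have "(\<lambda>n. LINT x:{A..B}|lborel. bump a b (real (Suc n)) x * w x) \<longlonglongrightarrow> c * (LINT x:{a..b}|lborel. 1)"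
      using tendsto_mult_left[OF lim[OF ab c1(2)], of c] key[OF ab] by (simp del: of_nat_Suc)
    then have "(LINT x:{a..b}|lborel. w x) = c * (LINT x:{a..b}|lborel. 1)"
      using lim[OF ab w] LIMSEQ_unique by blast
    moreover have "set_integrable lborel {a..b} w" "set_integrable lborel {a..b} (\<lambda>x. c)"
      using ab w c1 by (auto intro: set_integrable_subset)
    ultimately show "(LINT t:{a..b}|lborel. w t - c) = 0"
      by (simp flip: set_integral_mult_right)
  qed
  then show ?thesis by auto
qed

text \<open>The difference of \<open>u\<close> and the indefinite integral of \<open>g\<close> has
  zero weak derivative, hence is a.e. constant; adding that constant to the integral gives the
  representative.\<close>

lemma weak_deriv_obtain_primitive:
  assumes u: "set_integrable lborel {A..B} u" and g: "set_integrable lborel {A..B} g"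
    and "A < B" and wd: "weak_deriv_on {A<..<B} u g"
  obtains v where "primitive_on A B v g" "AE x in lborel. x \<in> {A<..<B} \<longrightarrow> u x = v x"
proof -
  define h where "h = (\<lambda>x. LINT t:{A..x}|lborel. g t)"
  \<comment> \<open>The integral over the point A is read as one over the empty open
    interval.\<close>
  have hA: "h A = 0"
    unfolding h_def using LINT_Ioo_eq_Icc[of A A g] by (simp add: set_lebesgue_integral_def)
  have h: "primitive_on A B h g"
    unfolding primitive_on_def hA using g by (simp add: h_def)
  have ch: "continuous_on {A..B} h" by (rule primitive_on_continuous[OF h])
  have sh: "set_integrable lborel {A..B} h" by (intro borel_integrable_atLeastAtMost' ch)
  have "(LINT x:{A<..<B}|lborel. (u x - h x) * deriv \<phi> x) = 0" if t: "test_fun {A<..<B} \<phi>" for \<phi>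
  proof -
    have 1: "(LINT x:{A<..<B}|lborel. u x * deriv \<phi> x) = - (LINT x:{A<..<B}|lborel. g x * \<phi> x)"
      using wd t unfolding weak_deriv_on_def by blast
    have 2: "(LINT x:{A<..<B}|lborel. h x * deriv \<phi> x) = - (LINT x:{A<..<B}|lborel. g x * \<phi> x)"
      using primitive_on_imp_weak_deriv[OF h] \<open>A < B\<close> t unfolding weak_deriv_on_def by simp
    have i: "set_integrable lborel {A<..<B} (\<lambda>x. deriv \<phi> x * u x)" "set_integrable lborel {A<..<B} (\<lambda>x. deriv \<phi> x * h x)"
      unfolding set_integrable_Ioo_iff_Icc
      by (intro set_integrable_continuous_mult test_fun_continuous_deriv[OF t] u sh)+
    have "(LINT x:{A<..<B}|lborel. (u x - h x) * deriv \<phi> x)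
        = (LINT x:{A<..<B}|lborel. deriv \<phi> x * u x - deriv \<phi> x * h x)"
      by (simp add: algebra_simps)
    also have "\<dots> = (LINT x:{A<..<B}|lborel. deriv \<phi> x * u x) - (LINT x:{A<..<B}|lborel. deriv \<phi> x * h x)"
      by (rule set_integral_diff(2)[OF i])
    finally show ?thesis using 1 2 by (simp add: mult.commute)
  qed
  then have "\<exists>c. AE x in lborel. x \<in> {A<..<B} \<longrightarrow> u x - h x = c"
    by (intro du_Bois_Reymond set_integral_diff(1) u sh \<open>A < B\<close>)
  then obtain c where c: "AE x in lborel. x \<in> {A<..<B} \<longrightarrow> u x - h x = c" by blast
  have "primitive_on A B (\<lambda>x. h x + c) g"
    unfolding primitive_on_def using g by (simp only: hA) (simp add: h_def)
  moreover have "AE x in lborel. x \<in> {A<..<B} \<longrightarrow> u x = h x + c"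
    using c by (auto elim!: eventually_mono)
  ultimately show thesis by (rule that)
qed

section \<open>Lower bound on the unit interval\<close>

lemma LINT_pos:
  fixes h :: "real \<Rightarrow> real"
  assumes "continuous_on {a..b} h" "a < b" "\<And>x. x \<in> {a..b} \<Longrightarrow> 0 \<le> h x" "y \<in> {a..b}" "h y \<noteq> 0"
  shows "0 < (LINT x:{a..b}|lborel. h x)"
proof -
  have "integral {a..b} h \<noteq> 0"
    using assms integral_eq_0_iff[of a b h] by blast
  moreover have "0 \<le> integral {a..b} h"
    using assms by (intro integral_nonneg integrable_continuous_real) auto
  moreover have "(LINT x:{a..b}|lborel. h x) = integral {a..b} h"
    by (intro set_borel_integral_eq_integral(2) borel_integrable_atLeastAtMost' assms)
  ultimately show ?thesis by simp
qed

lemma set_nn_integral_eq_LINT: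
  fixes f :: "real \<Rightarrow> real"
  assumes "set_integrable lborel A f" "\<And>x. x \<in> A \<Longrightarrow> 0 \<le> f x"
  shows "(\<integral>\<^sup>+ x\<in>A. ennreal (f x) \<partial>lborel) = ennreal (LINT x:A|lborel. f x)"
proof -
  have "(\<integral>\<^sup>+ x\<in>A. ennreal (f x) \<partial>lborel) = (\<integral>\<^sup>+ x. ennreal (indicator A x *\<^sub>R f x) \<partial>lborel)"
    by (rule nn_integral_cong) (auto simp: indicator_def)
  also have "\<dots> = ennreal (LINT x:A|lborel. f x)"
    unfolding set_lebesgue_integral_def
    by (rule nn_integral_eq_integral) (use assms in \<open>auto simp: set_integrable_def indicator_def\<close>)
  finally show ?thesis .
qed

lemma AE_Ioo_imp_Icc:
  assumes "AE x in lborel. x \<in> {a<..<b} \<longrightarrow> P x"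
  shows "AE x in lborel. x \<in> {a..b::real} \<longrightarrow> P x"
  using assms AE_lborel_singleton[of a] AE_lborel_singleton[of b]
  by eventually_elim auto

lemma ex_positive_if_mean_zero:
  fixes f :: "real \<Rightarrow> real"
  assumes "continuous_on {a..b} f" "a < b" "(LINT x:{a..b}|lborel. f x) = 0" "y \<in> {a..b}" "f y \<noteq> 0"
  shows "\<exists>p\<in>{a..b}. f p > 0"
proof (rule ccontr)
  assume "\<not> ?thesis"
  then have "\<And>x. x \<in> {a..b} \<Longrightarrow> 0 \<le> - f x" by force
  then have "0 < (LINT x:{a..b}|lborel. - f x)"
    using assms by (intro LINT_pos[of _ _ _ y] continuous_intros) auto
  moreover have "(LINT x:{a..b}|lborel. - f x) = - (LINT x:{a..b}|lborel. f x)"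
    using borel_integrable_atLeastAtMost'[OF assms(1)] by (rule set_integral_uminus)
  ultimately show False using assms(3) by simp
qed

text \<open>Splitting at a sign change yields strictness without analysing the equality case: each half has
  strictly less mass than the whole.\<close>

lemma sextic_bound_mean_zero:
  assumes f: "primitive_on a b f g" and "a < b"
    and g2: "set_integrable lborel {a..b} (\<lambda>x. (g x)\<^sup>2)"
    and mean: "(LINT x:{a..b}|lborel. f x) = 0" and nz: "y \<in> {a..b}" "f y \<noteq> 0"
  shows "pi\<^sup>2 / 16 * (LINT x:{a..b}|lborel. f x ^ 6)
           < (LINT x:{a..b}|lborel. (g x)\<^sup>2) * (LINT x:{a..b}|lborel. (f x)\<^sup>2)\<^sup>2"
proof -
  have cf: "continuous_on {a..b} f" by (rule primitive_on_continuous[OF f])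
  obtain p where p: "p \<in> {a..b}" "f p > 0"
    using ex_positive_if_mean_zero[OF cf \<open>a < b\<close> mean nz] by blast
  have "(LINT x:{a..b}|lborel. - f x) = 0"
    using borel_integrable_atLeastAtMost'[OF cf] mean by (simp add: set_integral_uminus)
  then obtain q where q: "q \<in> {a..b}" "f q < 0"
    using ex_positive_if_mean_zero[of a b "\<lambda>x. - f x" y] continuous_on_minus[OF cf] \<open>a < b\<close> nz by auto
  \<comment> \<open>The points l and r record that f is nonzero somewhere on each side of the zero
    z, so both pieces have positive mass.\<close>
  obtain z l r where z: "f z = 0" "l \<in> {a..b}" "r \<in> {a..b}" "f l \<noteq> 0" "f r \<noteq> 0" "l < z" "z < r"
  proof (cases "p < q")
    case True
    have "\<exists>z\<ge>p. z \<le> q \<and> f z = 0"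
      using p q True by (intro IVT2') (auto intro!: continuous_on_subset[OF cf])
    then obtain z where "p \<le> z" "z \<le> q" "f z = 0" by blast
    then show ?thesis using p q that[of z p q] by (cases "p = z"; cases "q = z") auto
  next
    case False
    have "\<exists>z\<ge>q. z \<le> p \<and> f z = 0"
      using p q False by (intro IVT') (auto intro!: continuous_on_subset[OF cf])
    then obtain z where "q \<le> z" "z \<le> p" "f z = 0" by blast
    then show ?thesis using p q that[of z q p] by (cases "p = z"; cases "q = z") auto
  qed
  have az: "a < z" "z < b" using z by auto
  define D1 where "D1 = (LINT x:{a..z}|lborel. (g x)\<^sup>2)"
  define D2 where "D2 = (LINT x:{z..b}|lborel. (g x)\<^sup>2)"
  define M1 where "M1 = (LINT x:{a..z}|lborel. (f x)\<^sup>2)"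
  define M2 where "M2 = (LINT x:{z..b}|lborel. (f x)\<^sup>2)"
  define S1 where "S1 = (LINT x:{a..z}|lborel. f x ^ 6)"
  define S2 where "S2 = (LINT x:{z..b}|lborel. f x ^ 6)"
  have c1: "continuous_on {a..z} f" and c2: "continuous_on {z..b} f"
    using az by (auto intro!: continuous_on_subset[OF cf])
  have pos: "0 < M1" "0 < M2" "0 < S1"
  proof -
    show "0 < M1" unfolding M1_def by (rule LINT_pos[of _ _ _ l]) (use az z in \<open>auto intro!: continuous_intros c1\<close>)
    show "0 < M2" unfolding M2_def by (rule LINT_pos[of _ _ _ r]) (use az z in \<open>auto intro!: continuous_intros c2\<close>)
    show "0 < S1" unfolding S1_def by (rule LINT_pos[of _ _ _ l]) (use az z in \<open>auto intro!: continuous_intros c1\<close>)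
  qed
  have g1: "set_integrable lborel {a..z} (\<lambda>x. (g x)\<^sup>2)" and g2': "set_integrable lborel {z..b} (\<lambda>x. (g x)\<^sup>2)"
    using az by (auto intro!: set_integrable_subset[OF g2])
  have b1: "pi\<^sup>2 / 16 * S1 \<le> D1 * M1\<^sup>2"
    unfolding S1_def D1_def M1_def
    by (rule sextic_bound_vanishing_endpoint[OF primitive_on_subinterval[OF f] _ g1]) (use az z in auto)
  have b2: "pi\<^sup>2 / 16 * S2 \<le> D2 * M2\<^sup>2"
    unfolding S2_def D2_def M2_def
    by (rule sextic_bound_vanishing_endpoint[OF primitive_on_subinterval[OF f] _ g2']) (use az z in auto)
  \<comment> \<open>Replacing M1 by the larger total mass is a strict gain only if the energy D1 is
    positive; the bound for the left piece forces this because S1 > 0.\<close>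
  have "D1 * M1\<^sup>2 > 0"
    using b1 pos by (smt (verit) mult_pos_pos pi_gt_zero zero_less_power divide_pos_pos)
  then have D1: "D1 > 0" using pos by (simp add: zero_less_mult_iff)
  have D2: "D2 \<ge> 0" unfolding D2_def set_lebesgue_integral_def by (intro integral_nonneg_AE AE_I2) auto
  have "M1\<^sup>2 < (M1 + M2)\<^sup>2" "M2\<^sup>2 \<le> (M1 + M2)\<^sup>2"
    using pos by (auto intro!: power_strict_mono power_mono)
  then have "D1 * M1\<^sup>2 + D2 * M2\<^sup>2 < D1 * (M1 + M2)\<^sup>2 + D2 * (M1 + M2)\<^sup>2"
    using D1 D2 by (intro add_less_le_mono mult_strict_left_mono mult_left_mono)
  with b1 b2 have "pi\<^sup>2 / 16 * (S1 + S2) < (D1 + D2) * (M1 + M2)\<^sup>2"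
    by (simp add: algebra_simps)
  moreover have "(LINT x:{a..b}|lborel. f x ^ 6) = S1 + S2" "(LINT x:{a..b}|lborel. (f x)\<^sup>2) = M1 + M2"
    unfolding S1_def S2_def M1_def M2_def using az
    by (auto intro!: LINT_Icc_split borel_integrable_atLeastAtMost' continuous_intros cf)
  moreover have "(LINT x:{a..b}|lborel. (g x)\<^sup>2) = D1 + D2"
    unfolding D1_def D2_def using az g2 by (intro LINT_Icc_split) auto
  ultimately show ?thesis by simp
qed

text \<open>The mean-zero inequality is applied to the continuous representative minus its mean; the
  mass in the numerator is that of \<open>u\<close> itself, which is at least as large. Strictness
  for every admissible function gives both the lower bound and non-attainment.\<close>

lemma GQ_ratio_gt:
  assumes adm: "GQ_admissible u g"
  shows "ennreal (pi\<^sup>2 / 16) < GQ_ratio u g"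
proof -
  have u: "set_integrable lborel {0..1} u" and g: "set_integrable lborel {0..1} g"
    and wd: "weak_deriv_on {0<..<1} u g"
    using adm by (auto simp: GQ_admissible_def W11_I_def set_integrable_Ioo_iff_Icc)
  obtain v where v: "primitive_on 0 1 v g" and "AE x in lborel. x \<in> {0<..<1} \<longrightarrow> u x = v x"
    using weak_deriv_obtain_primitive[OF u g _ wd] by auto
  then have uv: "AE x in lborel. x \<in> {0..1} \<longrightarrow> u x = v x" by (intro AE_Ioo_imp_Icc)
  have cv: "continuous_on {0..1} v" by (rule primitive_on_continuous[OF v])
  define \<mu> where "\<mu> = mean_I u"
  define f where "f = (\<lambda>x. v x - \<mu>)"
  have cf: "continuous_on {0..1} f" unfolding f_def by (intro continuous_intros cv)
  have um: "(\<lambda>x. indicator {0..1} x *\<^sub>R u x) \<in> borel_measurable lborel"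
    using u unfolding set_integrable_def by auto
  have vi: "set_integrable lborel {0..1} v" by (intro borel_integrable_atLeastAtMost' cv)
  then have vm: "(\<lambda>x. indicator {0..1} x *\<^sub>R v x) \<in> borel_measurable lborel"
    unfolding set_integrable_def by auto
  have \<mu>: "\<mu> = (LINT x:{0..1}|lborel. v x)"
    unfolding \<mu>_def mean_I_def set_lebesgue_integral_def
    by (rule integral_cong_AE[OF um vm]) (use uv in \<open>auto elim!: eventually_mono simp: indicator_def\<close>)
  have c01: "set_integrable lborel {0..1} (\<lambda>x::real. c::real)" for c
    by (intro borel_integrable_atLeastAtMost' continuous_intros)
  have const: "(LINT x:{0..1::real}|lborel. c) = (c::real)" for c
    by (simp add: set_lebesgue_integral_def)
  have mean: "(LINT x:{0..1}|lborel. f x) = 0"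
    unfolding f_def using vi c01 by (simp add: const \<mu>[symmetric])
  have pf: "primitive_on 0 1 f g"
    using v unfolding primitive_on_def f_def by (metis add_diff_eq add.commute diff_add_eq)
  obtain y where y: "y \<in> {0..1}" "f y \<noteq> 0"
  proof (rule ccontr)
    assume "\<not> thesis"
    with that have "\<And>y. y \<in> {0..1} \<Longrightarrow> v y = \<mu>" by (auto simp: f_def)
    then have "AE x in lborel. x \<in> {0..1} \<longrightarrow> u x = \<mu>" using uv by (auto elim!: eventually_mono)
    then show False using adm unfolding GQ_admissible_def by blast
  qed
  define S where "S = (LINT x:{0..1}|lborel. f x ^ 6)"
  define M where "M = (LINT x:{0..1}|lborel. (v x)\<^sup>2)"
  define F where "F = (LINT x:{0..1}|lborel. (f x)\<^sup>2)"
  have S0: "S > 0" and F0: "F > 0" unfolding S_def F_def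
    using y by (auto intro!: LINT_pos[of _ _ _ y] continuous_intros cf)
  have FM: "F \<le> M"
  proof -
    \<comment> \<open>Pythagoras: the cross term drops out because f has mean zero, leaving M = F +
      \<mu>^2.\<close>
    have "M = (LINT x:{0..1}|lborel. (f x)\<^sup>2 + (2 * \<mu> * f x + \<mu>\<^sup>2))"
      unfolding M_def f_def by (simp add: power2_eq_square algebra_simps)
    also have "\<dots> = F + (2 * \<mu> * (LINT x:{0..1}|lborel. f x) + \<mu>\<^sup>2)"
    proof -
      have 1: "set_integrable lborel {0..1} (\<lambda>x. (f x)\<^sup>2)" "set_integrable lborel {0..1} f"
        by (intro borel_integrable_atLeastAtMost' continuous_intros cf)+
      then show ?thesis unfolding F_def using c01 by (simp add: const)
    qed
    finally show ?thesis using mean by simp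
  qed
  have "(\<integral>\<^sup>+ x\<in>{0..1}. ennreal (\<bar>u x - mean_I u\<bar>^6) \<partial>lborel) = (\<integral>\<^sup>+ x\<in>{0..1}. ennreal (f x ^ 6) \<partial>lborel)"
    by (rule nn_integral_cong_AE)
       (use uv in \<open>auto elim!: eventually_mono simp: indicator_def f_def \<mu>_def power_even_abs\<close>)
  also have "\<dots> = ennreal S" unfolding S_def
    by (intro set_nn_integral_eq_LINT borel_integrable_atLeastAtMost' continuous_intros cf) auto
  finally have den: "(\<integral>\<^sup>+ x\<in>{0..1}. ennreal (\<bar>u x - mean_I u\<bar>^6) \<partial>lborel) = ennreal S" .
  have "(\<integral>\<^sup>+ x\<in>{0..1}. ennreal ((u x)\<^sup>2) \<partial>lborel) = (\<integral>\<^sup>+ x\<in>{0..1}. ennreal ((v x)\<^sup>2) \<partial>lborel)"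
    by (rule nn_integral_cong_AE) (use uv in \<open>auto elim!: eventually_mono simp: indicator_def\<close>)
  also have "\<dots> = ennreal M" unfolding M_def
    by (intro set_nn_integral_eq_LINT borel_integrable_atLeastAtMost' continuous_intros cv) auto
  finally have mass: "(\<integral>\<^sup>+ x\<in>{0..1}. ennreal ((u x)\<^sup>2) \<partial>lborel) = ennreal M" .
  have gm: "(\<lambda>x. indicator {0..1} x *\<^sub>R g x) \<in> borel_measurable lborel"
    using g unfolding set_integrable_def by auto
  have gsq: "(\<lambda>x. indicator {0..1} x *\<^sub>R (g x)\<^sup>2) = (\<lambda>x. (indicator {0..1} x *\<^sub>R g x)\<^sup>2)"
    by (auto simp: indicator_def)
  show ?thesis
  proof (cases "(\<integral>\<^sup>+ x\<in>{0..1}. ennreal ((g x)\<^sup>2) \<partial>lborel) = \<infinity>")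
    case True
    \<comment> \<open>Membership in W^{1,1} allows infinite energy. The mass is positive here, so
      the numerator is infinite and not a product of infinity with 0, and the denominator is
      finite.\<close>
    have "GQ_ratio u g = top"
      unfolding GQ_ratio_def den mass True using S0 F0 FM
      by (simp add: ennreal_top_mult ennreal_top_divide ennreal_power)
    then show ?thesis by simp
  next
    case False
    have "integrable lborel (\<lambda>x. indicator {0..1} x *\<^sub>R (g x)\<^sup>2)"
    proof (rule integrableI_nonneg)
      show "(\<lambda>x. indicator {0..1} x *\<^sub>R (g x)\<^sup>2) \<in> borel_measurable lborel"
        unfolding gsq using gm by measurable
      have "(\<integral>\<^sup>+ x. ennreal (indicator {0..1} x *\<^sub>R (g x)\<^sup>2) \<partial>lborel) = (\<integral>\<^sup>+ x\<in>{0..1}. ennreal ((g x)\<^sup>2) \<partial>lborel)"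
        by (rule nn_integral_cong) (auto simp: indicator_def)
      then show "(\<integral>\<^sup>+ x. ennreal (indicator {0..1} x *\<^sub>R (g x)\<^sup>2) \<partial>lborel) < \<infinity>"
        using False by (simp add: less_top)
    qed auto
    then have g2: "set_integrable lborel {0..1} (\<lambda>x. (g x)\<^sup>2)" unfolding set_integrable_def .
    define D where "D = (LINT x:{0..1}|lborel. (g x)\<^sup>2)"
    have D0: "D \<ge> 0" unfolding D_def set_lebesgue_integral_def by (intro integral_nonneg_AE AE_I2) auto
    have dir: "(\<integral>\<^sup>+ x\<in>{0..1}. ennreal ((g x)\<^sup>2) \<partial>lborel) = ennreal D"
      unfolding D_def by (intro set_nn_integral_eq_LINT g2) auto
    have "pi\<^sup>2 / 16 * S < D * F\<^sup>2"
      unfolding S_def D_def F_def by (rule sextic_bound_mean_zero[OF pf _ g2 mean y]) simp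
    also have "D * F\<^sup>2 \<le> D * M\<^sup>2"
      using D0 F0 FM by (intro mult_left_mono power_mono) auto
    finally have "pi\<^sup>2 / 16 < D * M\<^sup>2 / S" using S0 by (simp add: field_simps)
    moreover have "GQ_ratio u g = ennreal (D * M\<^sup>2 / S)"
      unfolding GQ_ratio_def den mass dir using S0 F0 FM D0
      by (simp add: ennreal_power ennreal_mult[symmetric] divide_ennreal)
    ultimately show ?thesis by (simp add: ennreal_less_iff)
  qed
qed

section \<open>Lower bound on the line\<close>

lemma test_fun_deriv_zero:
  assumes "test_fun U \<phi>" "x \<notin> U" shows "deriv \<phi> x = 0"
proof -
  let ?S = "- closure {x. \<phi> x \<noteq> 0}"
  have x: "x \<in> ?S" using assms unfolding test_fun_def by auto
  have z: "0 = \<phi> y" if "y \<in> ?S" for y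
    using that closure_subset[of "{x. \<phi> x \<noteq> 0}"] by auto
  have "(\<phi> has_real_derivative 0) (at x)"
    by (rule has_field_derivative_transform_within_open[OF DERIV_const open_Compl[OF closed_closure] x z])
  then show ?thesis by (rule DERIV_imp_deriv)
qed

lemma LINT_test_fun_subset:
  assumes t: "test_fun U \<phi>" and "U \<subseteq> V"
  shows "(LINT x:V|lborel. u x * deriv \<phi> x) = (LINT x:U|lborel. u x * deriv \<phi> x)"
    and "(LINT x:V|lborel. g x * \<phi> x) = (LINT x:U|lborel. g x * \<phi> x)"
  unfolding set_lebesgue_integral_def
  by (rule Bochner_Integration.integral_cong;
      use assms(2) test_fun_deriv_zero[OF t] test_fun_zero[OF t] in \<open>auto simp: indicator_def\<close>)+

lemma weak_deriv_on_subset: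
  assumes "weak_deriv_on V u g" "U \<subseteq> V"
  shows "weak_deriv_on U u g"
  unfolding weak_deriv_on_def
proof (intro allI impI)
  fix \<phi> assume t: "test_fun U \<phi>"
  have "(LINT x:V|lborel. u x * deriv \<phi> x) = - (LINT x:V|lborel. g x * \<phi> x)"
    using assms t test_fun_subset unfolding weak_deriv_on_def by blast
  then show "(LINT x:U|lborel. u x * deriv \<phi> x) = - (LINT x:U|lborel. g x * \<phi> x)"
    by (simp only: LINT_test_fun_subset[OF t assms(2)])
qed

lemma set_integrable_if_integrable:
  fixes f :: "real \<Rightarrow> real"
  assumes "integrable lborel f" shows "set_integrable lborel {a..b} f"
  by (rule set_integrable_subset[of _ UNIV]) (use assms in \<open>simp_all add: set_integrable_def\<close>)

lemma set_integrable_if_square_integrable: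
  fixes u :: "real \<Rightarrow> real"
  assumes "u \<in> borel_measurable lborel" "integrable lborel (\<lambda>x. (u x)\<^sup>2)"
  shows "set_integrable lborel {a..b} u"
proof -
  have 1: "set_integrable lborel {a..b} (\<lambda>x. 1 + (u x)\<^sup>2)"
  proof (rule set_integral_add(1))
    show "set_integrable lborel {a..b} (\<lambda>x. 1::real)"
      by (intro borel_integrable_atLeastAtMost' continuous_intros)
    show "set_integrable lborel {a..b} (\<lambda>x. (u x)\<^sup>2)"
      by (rule set_integrable_if_integrable[OF assms(2)])
  qed
  show ?thesis
  proof (rule set_integrable_bound[OF 1])
    show "set_borel_measurable lborel {a..b} u"
      unfolding set_borel_measurable_def using assms(1) by measurable
    have "\<bar>u x\<bar> \<le> 1 + (u x)\<^sup>2" for x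
    proof -
      have "0 \<le> (\<bar>u x\<bar> - 1)\<^sup>2 + \<bar>u x\<bar>" by simp
      then show ?thesis by (simp add: power2_eq_square algebra_simps)
    qed
    then show "AE x in lborel. x \<in> {a..b} \<longrightarrow> norm (u x) \<le> norm (1 + (u x)\<^sup>2)"
      by (intro AE_I2) (auto simp: add_nonneg_nonneg)
  qed
qed

lemma ex_small_value:
  fixes v :: "real \<Rightarrow> real"
  assumes "continuous_on {a..b} v" "a < b" "(LINT x:{a..b}|lborel. (v x)\<^sup>2) \<le> \<epsilon> * (b - a)"
  shows "\<exists>x\<in>{a..b}. (v x)\<^sup>2 \<le> \<epsilon>"
proof (rule ccontr)
  assume "\<not> ?thesis"
  then have gt: "\<And>x. x \<in> {a..b} \<Longrightarrow> \<epsilon> < (v x)\<^sup>2" by force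
  have i: "set_integrable lborel {a..b} (\<lambda>x. (v x)\<^sup>2)" "set_integrable lborel {a..b} (\<lambda>x. \<epsilon>)"
    by (intro borel_integrable_atLeastAtMost' continuous_intros assms)+
  have "0 < (LINT x:{a..b}|lborel. (v x)\<^sup>2 - \<epsilon>)"
    using assms gt by (intro LINT_pos[of _ _ _ a] continuous_intros) (auto simp: less_imp_le, force)
  also have "\<dots> = (LINT x:{a..b}|lborel. (v x)\<^sup>2) - (LINT x:{a..b}|lborel. \<epsilon>)"
    using i by simp
  also have "(LINT x:{a..b}|lborel. \<epsilon>) = \<epsilon> * (b - a)"
    using assms by (simp add: set_lebesgue_integral_def)
  finally show False using assms by simp
qed

lemma LINT_Icc_mono:
  fixes f :: "real \<Rightarrow> real"
  assumes "set_integrable lborel {a..b} f" "\<And>x. 0 \<le> f x" "a \<le> c" "d \<le> b"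
  shows "(LINT x:{c..d}|lborel. f x) \<le> (LINT x:{a..b}|lborel. f x)"
proof -
  have "set_integrable lborel {c..d} f"
    using assms by (auto intro: set_integrable_subset)
  then show ?thesis
    using assms unfolding set_lebesgue_integral_def set_integrable_def
    by (intro integral_mono) (auto simp: indicator_def)
qed

lemma LINT_Icc_le_integral:
  fixes f :: "real \<Rightarrow> real"
  assumes "integrable lborel f" "\<And>x. 0 \<le> f x"
  shows "(LINT x:{a..b}|lborel. f x) \<le> (\<integral>x. f x \<partial>lborel)"
  unfolding set_lebesgue_integral_def
proof (rule integral_mono)
  show "integrable lborel (\<lambda>x. indicator {a..b} x *\<^sub>R f x)"
    using set_integrable_if_integrable[OF assms(1)] unfolding set_integrable_def .
qed (use assms in \<open>auto simp: indicator_def\<close>)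

text \<open>Decay at infinity is replaced by averaging: a function of mass at most M has, in each
  window of length L with M \<le> \<epsilon> L, a point where its square is at most \<epsilon>.
  Cutting at such points on both sides of [-N, N] makes the boundary contribution at most
  \<epsilon>/2.\<close>

lemma H1_sextic_bound:
  assumes H: "H1_R u g"
  shows "(\<integral>\<^sup>+ x. ennreal ((u x)^6) \<partial>lborel)
           \<le> ennreal (4 / pi\<^sup>2 * (\<integral>x. (g x)\<^sup>2 \<partial>lborel) * (\<integral>x. (u x)\<^sup>2 \<partial>lborel)\<^sup>2)"
proof -
  have um: "u \<in> borel_measurable lborel" and u2: "integrable lborel (\<lambda>x. (u x)\<^sup>2)"
    and gm: "g \<in> borel_measurable lborel" and g2: "integrable lborel (\<lambda>x. (g x)\<^sup>2)"
    and wd: "weak_deriv_on UNIV u g"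
    using H unfolding H1_R_def by auto
  define D where "D = (\<integral>x. (g x)\<^sup>2 \<partial>lborel)"
  define M where "M = (\<integral>x. (u x)\<^sup>2 \<partial>lborel)"
  have M0: "M \<ge> 0" and D0: "D \<ge> 0" unfolding M_def D_def by auto
  have eps: "(\<integral>\<^sup>+ x\<in>{- real N..real N}. ennreal ((u x)^6) \<partial>lborel) \<le> ennreal (4 / pi\<^sup>2 * (D + \<epsilon> / 2) * (M + 2 * \<epsilon>)\<^sup>2)"
    if e: "\<epsilon> > 0" for \<epsilon> N
  proof -
    \<comment> \<open>The summand 1 keeps the windows nondegenerate when M = 0.\<close>
    define L where "L = M / \<epsilon> + 1"
    define A B where "A = - real N - L" and "B = real N + L"
    have L: "L > 0" "M \<le> \<epsilon> * L" using M0 e by (auto simp: L_def field_simps add_pos_nonneg)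
    have AB: "A < B" using L by (simp add: A_def B_def)
    obtain v where v: "primitive_on A B v g" and "AE x in lborel. x \<in> {A<..<B} \<longrightarrow> u x = v x"
      using weak_deriv_obtain_primitive[OF set_integrable_if_square_integrable[OF um u2]
          set_integrable_if_square_integrable[OF gm g2] AB weak_deriv_on_subset[OF wd]] by blast
    then have uv: "AE x in lborel. x \<in> {A..B} \<longrightarrow> u x = v x" by (intro AE_Ioo_imp_Icc)
    have cv: "continuous_on {A..B} v" by (rule primitive_on_continuous[OF v])
    have v2: "set_integrable lborel {A..B} (\<lambda>x. (v x)\<^sup>2)"
      by (intro borel_integrable_atLeastAtMost' continuous_intros cv)
    have v6: "set_integrable lborel {A..B} (\<lambda>x. v x ^ 6)"
      by (intro borel_integrable_atLeastAtMost' continuous_intros cv)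
    have "(LINT x:{A..B}|lborel. (v x)\<^sup>2) = (LINT x:{A..B}|lborel. (u x)\<^sup>2)"
      unfolding set_lebesgue_integral_def
    proof (rule integral_cong_AE)
      show "(\<lambda>x. indicator {A..B} x *\<^sub>R (v x)\<^sup>2) \<in> borel_measurable lborel"
        using v2 unfolding set_integrable_def by auto
      show "(\<lambda>x. indicator {A..B} x *\<^sub>R (u x)\<^sup>2) \<in> borel_measurable lborel"
        using um by measurable
    qed (use uv in \<open>auto elim!: eventually_mono simp: indicator_def\<close>)
    also have "\<dots> \<le> M" unfolding M_def by (intro LINT_Icc_le_integral u2) auto
    finally have vM: "(LINT x:{A..B}|lborel. (v x)\<^sup>2) \<le> M" .
    have sub: "(LINT x:{c..d}|lborel. (v x)\<^sup>2) \<le> M" if "A \<le> c" "d \<le> B" for c d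
      using LINT_Icc_mono[OF v2 _ that] vM by auto
    have len: "A + L = - real N" "real N + L = B" by (simp_all add: A_def B_def)
    have small: "\<exists>x\<in>{c..d}. (v x)\<^sup>2 \<le> \<epsilon>" if "A \<le> c" "d \<le> B" "c + L = d" for c d
    proof (rule ex_small_value)
      show "continuous_on {c..d} v" using that by (intro continuous_on_subset[OF cv]) auto
      have "d - c = L" using that by simp
      then show "(LINT x:{c..d}|lborel. (v x)\<^sup>2) \<le> \<epsilon> * (d - c)" using sub[OF that(1,2)] L by simp
    qed (use that L in auto)
    obtain a where a: "a \<in> {A..- real N}" "(v a)\<^sup>2 \<le> \<epsilon>"
      using small[of A "- real N"] len L by auto
    obtain b where b: "b \<in> {real N..B}" "(v b)\<^sup>2 \<le> \<epsilon>"
      using small[of "real N" B] len L by auto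
    have ab: "A \<le> a" "a \<le> - real N" "real N \<le> b" "b \<le> B" "a \<le> b" using a b by auto
    have g2s: "set_integrable lborel {a..b} (\<lambda>x. (g x)\<^sup>2)"
      by (rule set_integrable_if_integrable[OF g2])
    have sq: "w ^ 4 \<le> \<epsilon>\<^sup>2" if "w\<^sup>2 \<le> \<epsilon>" for w :: real
      using power_mono[OF that, of 2] by simp
    have small: "(v a ^ 4 + v b ^ 4) / (4 * \<epsilon>) \<le> \<epsilon> / 2"
      using sq[OF a(2)] sq[OF b(2)] e by (simp add: field_simps power2_eq_square)
    have Dab: "(LINT x:{a..b}|lborel. (g x)\<^sup>2) \<le> D"
      unfolding D_def by (intro LINT_Icc_le_integral g2) auto
    have M1: "0 \<le> (LINT x:{a..b}|lborel. (v x)\<^sup>2)"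
      unfolding set_lebesgue_integral_def by (intro integral_nonneg_AE AE_I2) auto
    have "pi\<^sup>2 / 4 * (LINT x:{a..b}|lborel. v x ^ 6)
           \<le> ((LINT x:{a..b}|lborel. (g x)\<^sup>2) + (v a ^ 4 + v b ^ 4) / (4 * \<epsilon>))
               * ((LINT x:{a..b}|lborel. (v x)\<^sup>2) + 2 * \<epsilon>)\<^sup>2"
      by (rule sextic_bound_small_endpoints[OF primitive_on_subinterval[OF v] _ e g2s]) (use ab in auto)
    also have "\<dots> \<le> (D + \<epsilon> / 2) * (M + 2 * \<epsilon>)\<^sup>2"
      using small Dab sub[of a b] ab e M1 D0 by (intro mult_mono power_mono add_mono) auto
    finally have "(LINT x:{a..b}|lborel. v x ^ 6) \<le> 4 / pi\<^sup>2 * (D + \<epsilon> / 2) * (M + 2 * \<epsilon>)\<^sup>2"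
      by (simp add: field_simps)
    moreover have "(LINT x:{- real N..real N}|lborel. v x ^ 6) \<le> (LINT x:{a..b}|lborel. v x ^ 6)"
      using ab by (intro LINT_Icc_mono set_integrable_subset[OF v6]) auto
    ultimately have le: "(LINT x:{- real N..real N}|lborel. v x ^ 6) \<le> 4 / pi\<^sup>2 * (D + \<epsilon> / 2) * (M + 2 * \<epsilon>)\<^sup>2"
      by linarith
    have "(\<integral>\<^sup>+ x\<in>{- real N..real N}. ennreal ((u x)^6) \<partial>lborel) = (\<integral>\<^sup>+ x\<in>{- real N..real N}. ennreal ((v x)^6) \<partial>lborel)"
      by (rule nn_integral_cong_AE)
         (use uv ab in \<open>auto elim!: eventually_mono simp: indicator_def\<close>)
    also have "\<dots> = ennreal (LINT x:{- real N..real N}|lborel. v x ^ 6)"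
      using ab by (intro set_nn_integral_eq_LINT set_integrable_subset[OF v6]) auto
    finally show ?thesis using le by (simp add: ennreal_leI)
  qed
  have N: "(\<integral>\<^sup>+ x\<in>{- real N..real N}. ennreal ((u x)^6) \<partial>lborel) \<le> ennreal (4 / pi\<^sup>2 * D * M\<^sup>2)" for N
  proof -
    \<comment> \<open>The limit in \<epsilon> is taken with N fixed: the interval, its
      representative and the cut points change with \<epsilon>, but the left-hand side involves only
      \<open>u\<close> and N. Monotone convergence in N follows.\<close>
    have "((\<lambda>\<epsilon>. ennreal (4 / pi\<^sup>2 * (D + \<epsilon> / 2) * (M + 2 * \<epsilon>)\<^sup>2)) \<longlongrightarrow> ennreal (4 / pi\<^sup>2 * (D + 0 / 2) * (M + 2 * 0)\<^sup>2)) (at_right 0)"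
      by (intro tendsto_intros tendsto_ennrealI) auto
    then have "(\<integral>\<^sup>+ x\<in>{- real N..real N}. ennreal ((u x)^6) \<partial>lborel) \<le> ennreal (4 / pi\<^sup>2 * (D + 0 / 2) * (M + 2 * 0)\<^sup>2)"
      by (rule tendsto_lowerbound) (use eps in \<open>auto intro!: eventually_at_rightI[of 0 1]\<close>)
    then show ?thesis by simp
  qed
  have "(\<integral>\<^sup>+ x. ennreal ((u x)^6) \<partial>lborel) = (\<integral>\<^sup>+ x. (SUP N. ennreal ((u x)^6) * indicator {- real N..real N} x) \<partial>lborel)"
  proof (rule nn_integral_cong)
    fix x
    obtain N where N: "\<bar>x\<bar> \<le> real N" using real_arch_simple by blast
    show "ennreal ((u x)^6) = (SUP N. ennreal ((u x)^6) * indicator {- real N..real N} x)"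
    proof (rule antisym)
      have "x \<in> {- real N..real N}" using N by auto
      then show "ennreal ((u x)^6) \<le> (SUP N. ennreal ((u x)^6) * indicator {- real N..real N} x)"
        by (intro SUP_upper2[of N]) auto
    qed (auto intro!: SUP_least simp: indicator_def)
  qed
  also have "\<dots> = (SUP N. \<integral>\<^sup>+ x\<in>{- real N..real N}. ennreal ((u x)^6) \<partial>lborel)"
    by (rule nn_integral_monotone_convergence_SUP)
       (use um in \<open>auto simp: incseq_def le_fun_def indicator_def\<close>)
  also have "\<dots> \<le> ennreal (4 / pi\<^sup>2 * D * M\<^sup>2)" by (intro SUP_least N)
  finally show ?thesis by (simp add: D_def M_def)
qed

text \<open>The sextic bound first shows that the denominator is finite, and \<open>u\<close> not
  being a.e. zero makes it positive; only then does the extended quotient reduce to a real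
  one.\<close>

lemma G_ratio_ge:
  assumes H: "H1_R u g" and nz: "\<not> (AE x in lborel. u x = 0)"
  shows "ennreal (pi\<^sup>2 / 4) \<le> G_ratio u g"
proof -
  have um: "u \<in> borel_measurable lborel" and u2: "integrable lborel (\<lambda>x. (u x)\<^sup>2)"
    and g2: "integrable lborel (\<lambda>x. (g x)\<^sup>2)"
    using H unfolding H1_R_def by auto
  define D where "D = (\<integral>x. (g x)\<^sup>2 \<partial>lborel)"
  define M where "M = (\<integral>x. (u x)\<^sup>2 \<partial>lborel)"
  define X where "X = (\<integral>\<^sup>+ x. ennreal ((u x)^6) \<partial>lborel)"
  have M0: "M \<ge> 0" and D0: "D \<ge> 0" unfolding M_def D_def by auto
  have X: "X \<le> ennreal (4 / pi\<^sup>2 * D * M\<^sup>2)"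
    using H1_sextic_bound[OF H] unfolding X_def D_def M_def .
  obtain S where S: "X = ennreal S" "0 \<le> S" "S \<le> 4 / pi\<^sup>2 * D * M\<^sup>2"
  proof (cases X)
    case (real r)
    then show ?thesis using that[of r] X D0 by simp
  next
    case top
    then show ?thesis using X by (simp add: top_unique)
  qed
  have "X \<noteq> 0"
  proof
    assume "X = 0"
    then have "AE x in lborel. ennreal ((u x)^6) = 0"
      unfolding X_def using um by (subst (asm) nn_integral_0_iff_AE) auto
    then have "AE x in lborel. u x = 0"
    proof (rule eventually_mono)
      fix x assume "ennreal ((u x)^6) = 0"
      then have "(u x)^6 \<le> 0" by (simp add: ennreal_eq_0_iff)
      moreover have "0 \<le> (u x)^6" by (intro zero_le_even_power) simp
      ultimately show "u x = 0" by simp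
    qed
    then show False using nz by blast
  qed
  then have S0: "S > 0" using S by (cases "S = 0") auto
  have "(\<integral>\<^sup>+ x. ennreal ((g x)\<^sup>2) \<partial>lborel) = ennreal D" "(\<integral>\<^sup>+ x. ennreal ((u x)\<^sup>2) \<partial>lborel) = ennreal M"
    unfolding D_def M_def using g2 u2 by (auto intro!: nn_integral_eq_integral)
  then have "G_ratio u g = ennreal (D * M\<^sup>2 / S)"
    unfolding G_ratio_def X_def[symmetric] S(1) using S0 M0 D0
    by (simp add: ennreal_power ennreal_mult[symmetric] divide_ennreal)
  moreover have "pi\<^sup>2 / 4 \<le> D * M\<^sup>2 / S"
    using S(3) S0 by (simp add: field_simps)
  ultimately show ?thesis by (simp add: ennreal_leI)
qed

section \<open>Extremal functions\<close>

lemma primitive_on_imp_weak_deriv_UNIV: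
  assumes "\<And>a b. primitive_on a b u g"
  shows "weak_deriv_on UNIV u g"
  unfolding weak_deriv_on_def
proof (intro allI impI)
  fix \<phi> assume t: "test_fun UNIV \<phi>"
  then have "bounded (closure {x. \<phi> x \<noteq> 0})"
    unfolding test_fun_def using compact_imp_bounded by blast
  then obtain R where R: "\<And>x. x \<in> closure {x. \<phi> x \<noteq> 0} \<Longrightarrow> \<bar>x\<bar> \<le> R"
    unfolding bounded_iff by auto
  define r where "r = \<bar>R\<bar> + 1"
  have "closure {x. \<phi> x \<noteq> 0} \<subseteq> {-r<..<r}" using R by (fastforce simp: r_def)
  then have t': "test_fun {-r<..<r} \<phi>" using t unfolding test_fun_def by blast
  have "(LINT x:{-r<..<r}|lborel. u x * deriv \<phi> x) = - (LINT x:{-r<..<r}|lborel. g x * \<phi> x)"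
    using primitive_on_imp_weak_deriv[OF assms, of "-r" r] t' unfolding weak_deriv_on_def r_def by auto
  then show "(LINT x:UNIV|lborel. u x * deriv \<phi> x) = - (LINT x:UNIV|lborel. g x * \<phi> x)"
    by (simp only: LINT_test_fun_subset[OF t' subset_UNIV])
qed

lemma filterlim_sinh_at_top: "filterlim (sinh :: real \<Rightarrow> real) at_top at_top"
proof (rule filterlim_at_top_mono)
  show "filterlim (\<lambda>x::real. - (1 / 2) + (1 / 2) * exp x) at_top at_top"
    by (intro filterlim_tendsto_add_at_top[OF tendsto_const]
        filterlim_tendsto_pos_mult_at_top[OF tendsto_const _ exp_at_top]) simp
  show "eventually (\<lambda>x::real. - (1 / 2) + (1 / 2) * exp x \<le> sinh x) at_top"
    using eventually_ge_at_top[of 0] by eventually_elim (simp add: sinh_field_def field_simps)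
qed

section \<open>The extremal profile and its integrals\<close>

text \<open>Equality in Wirtinger's inequality asks for w = cos(l s) in the mass variable; solving
  ds/dx = cos(l s) with s = 0 at x = 0 gives w = sech(l x), and v is its square root.\<close>

definition sech_root :: "real \<Rightarrow> real \<Rightarrow> real" where
  "sech_root l x = 1 / sqrt (cosh (l * x))"

definition sech_root_deriv :: "real \<Rightarrow> real \<Rightarrow> real" where
  "sech_root_deriv l x = - l * sinh (l * x) / (2 * cosh (l * x) * sqrt (cosh (l * x)))"

lemma DERIV_sech_root: "(sech_root l has_real_derivative sech_root_deriv l x) (at x)"
proof -
  have c: "cosh (l * x) > 0" by simp
  then have "\<not> cosh (l * x) < 0" by linarith
  with c have "((\<lambda>x. 1 / sqrt (cosh (l * x))) has_real_derivative sech_root_deriv l x) (at x)"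
    by (auto intro!: derivative_eq_intros simp: sech_root_deriv_def field_simps)
  then show ?thesis by (simp add: sech_root_def[abs_def])
qed

lemma continuous_on_sech_root: "continuous_on S (sech_root l)"
  by (meson DERIV_isCont DERIV_sech_root continuous_at_imp_continuous_on)

lemma continuous_on_sech_root_deriv: "continuous_on S (sech_root_deriv l)"
  unfolding sech_root_deriv_def[abs_def]
  by (intro continuous_intros) (simp add: less_imp_neq[symmetric] cosh_real_pos)

lemma primitive_on_sech_root: "primitive_on a b (sech_root l) (sech_root_deriv l)"
  by (intro primitive_on_C1 continuous_on_sech_root_deriv has_field_derivative_at_within[OF DERIV_sech_root])

lemma sech_root_power2: "(sech_root l x)\<^sup>2 = 1 / cosh (l * x)"
  by (simp add: sech_root_def power_divide)

lemma sech_root_power6: "sech_root l x ^ 6 = 1 / cosh (l * x) ^ 3"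
proof -
  have "sech_root l x ^ 6 = ((sech_root l x)\<^sup>2) ^ 3" by (simp flip: power_mult)
  then show ?thesis by (simp add: sech_root_power2 power_divide)
qed

text \<open>Thanks to sinh^2 = cosh^2 - 1 the energy is a combination of the mass and the sextic
  integral, so no third primitive is needed.\<close>

lemma sech_root_deriv_power2:
  "(sech_root_deriv l x)\<^sup>2 = l\<^sup>2 / 4 * ((sech_root l x)\<^sup>2 - sech_root l x ^ 6)"
proof -
  have c: "cosh (l * x) > 0" by simp
  have "(sech_root_deriv l x)\<^sup>2 = l\<^sup>2 * (sinh (l * x))\<^sup>2 / (4 * (cosh (l * x))\<^sup>2 * cosh (l * x))"
    by (simp add: sech_root_deriv_def power_divide power_mult_distrib)
  also have "\<dots> = l\<^sup>2 / 4 * (1 / cosh (l * x) - 1 / cosh (l * x) ^ 3)"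
    unfolding sinh_square_eq using c by (simp add: field_simps power2_eq_square power3_eq_cube)
  finally show ?thesis by (simp add: sech_root_power2 sech_root_power6)
qed

lemma sech_root_bounds: "0 < sech_root l x" "sech_root l x \<le> 1"
  using cosh_real_ge_1[of "l * x"] by (auto simp: sech_root_def)

text \<open>The Gudermannian function, a primitive of sech.\<close>

definition mass_primitive :: "real \<Rightarrow> real" where
  "mass_primitive y = arctan (sinh y)"

text \<open>The reduction formula for the integral of sech^3: half the sum of sech tanh and the
  Gudermannian.\<close>

definition sextic_primitive :: "real \<Rightarrow> real" where
  "sextic_primitive y = (sinh y / (cosh y)\<^sup>2 + arctan (sinh y)) / 2"

lemma DERIV_mass_primitive: "(mass_primitive has_real_derivative 1 / cosh y) (at y)"
proof -
  have c: "cosh y > 0" by simp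
  have "((\<lambda>y. arctan (sinh y)) has_real_derivative cosh y / (1 + (sinh y)\<^sup>2)) (at y)"
    by (auto intro!: derivative_eq_intros simp: field_simps)
  moreover have "1 + (sinh y)\<^sup>2 = (cosh y)\<^sup>2" by (simp add: cosh_square_eq)
  ultimately show ?thesis using c by (simp add: mass_primitive_def[abs_def] power2_eq_square)
qed

lemma DERIV_sextic_primitive: "(sextic_primitive has_real_derivative 1 / cosh y ^ 3) (at y)"
proof -
  have c: "cosh y > 0" by simp
  have "((\<lambda>y. sinh y / (cosh y)\<^sup>2) has_real_derivative
      (cosh y * (cosh y)\<^sup>2 - sinh y * (2 * cosh y * sinh y)) / ((cosh y)\<^sup>2)\<^sup>2) (at y)"
    using c by (auto intro!: derivative_eq_intros simp: power2_eq_square)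
  moreover have "(cosh y * (cosh y)\<^sup>2 - sinh y * (2 * cosh y * sinh y)) / ((cosh y)\<^sup>2)\<^sup>2 = 2 / cosh y ^ 3 - 1 / cosh y"
  proof -
    have "cosh y * (cosh y)\<^sup>2 - sinh y * (2 * cosh y * sinh y) = cosh y * (2 - (cosh y)\<^sup>2)"
      using cosh_square_eq[of y] by algebra
    then show ?thesis using c by (simp add: field_simps eval_nat_numeral)
  qed
  ultimately have "((\<lambda>y. sinh y / (cosh y)\<^sup>2) has_real_derivative 2 / cosh y ^ 3 - 1 / cosh y) (at y)" by simp
  from DERIV_cdivide[OF DERIV_add[OF this DERIV_mass_primitive], of 2]
  show ?thesis by (simp add: sextic_primitive_def[abs_def] mass_primitive_def[abs_def])
qed

lemma mass_primitive_at_top: "(mass_primitive \<longlongrightarrow> pi / 2) at_top"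
  unfolding mass_primitive_def[abs_def]
  by (rule filterlim_compose[OF tendsto_arctan_at_top filterlim_sinh_at_top])

lemma sextic_primitive_at_top: "(sextic_primitive \<longlongrightarrow> pi / 4) at_top"
proof -
  have "((\<lambda>y::real. inverse (sinh y)) \<longlongrightarrow> 0) at_top"
    by (rule filterlim_compose[OF tendsto_inverse_0_at_top[OF filterlim_ident] filterlim_sinh_at_top])
  then have "((\<lambda>y::real. sinh y / (cosh y)\<^sup>2) \<longlongrightarrow> 0) at_top"
  proof (rule Lim_null_comparison[rotated])
    show "eventually (\<lambda>y::real. norm (sinh y / (cosh y)\<^sup>2) \<le> inverse (sinh y)) at_top"
      using eventually_gt_at_top[of 0]
    proof eventually_elim
      case (elim y)
      then have "sinh y > 0" by simp
      moreover have "sinh y * sinh y \<le> cosh y * cosh y"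
        using cosh_square_eq[of y] by (simp add: power2_eq_square)
      ultimately show ?case by (simp add: field_simps power2_eq_square)
    qed
  qed
  from tendsto_divide[OF tendsto_add[OF this mass_primitive_at_top] tendsto_const[of 2]]
  show ?thesis by (simp add: sextic_primitive_def[abs_def] mass_primitive_def)
qed

lemma mass_primitive_at_bot: "(mass_primitive \<longlongrightarrow> - pi / 2) at_bot"
  unfolding filterlim_at_bot_mirror
  using tendsto_minus[OF mass_primitive_at_top] by (simp add: mass_primitive_def[abs_def] arctan_minus)

lemma sextic_primitive_at_bot: "(sextic_primitive \<longlongrightarrow> - pi / 4) at_bot"
  unfolding filterlim_at_bot_mirror
  using tendsto_minus[OF sextic_primitive_at_top]
  by (simp add: sextic_primitive_def[abs_def] arctan_minus add_divide_distrib diff_divide_distrib)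

lemma integral_UNIV_FTC_nonneg:
  fixes f F :: "real \<Rightarrow> real"
  assumes "\<And>x. (F has_real_derivative f x) (at x)" "\<And>x. isCont f x" "\<And>x. 0 \<le> f x"
    and "(F \<longlongrightarrow> A) at_bot" "(F \<longlongrightarrow> B) at_top"
  shows "integrable lborel f" "(\<integral>x. f x \<partial>lborel) = B - A"
proof -
  have "((F \<circ> real_of_ereal) \<longlongrightarrow> A) (at_right (-\<infinity>))" "((F \<circ> real_of_ereal) \<longlongrightarrow> B) (at_left \<infinity>)"
    using assms(4,5) by (simp_all add: ereal_tendsto_simps)
  from interval_integral_FTC_nonneg[OF _ assms(1,2) _ this] assms(3)
  have "set_integrable lborel (einterval (-\<infinity>) \<infinity>) f" "(LBINT x=-\<infinity>..\<infinity>. f x) = B - A"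
    by auto
  then show "integrable lborel f" "(\<integral>x. f x \<partial>lborel) = B - A"
    by (simp_all add: set_integrable_def interval_lebesgue_integral_def set_lebesgue_integral_def)
qed

lemma sech_root_UNIV:
  "integrable lborel (\<lambda>x. (sech_root 1 x)\<^sup>2)" "(\<integral>x. (sech_root 1 x)\<^sup>2 \<partial>lborel) = pi"
  "integrable lborel (\<lambda>x. sech_root 1 x ^ 6)" "(\<integral>x. sech_root 1 x ^ 6 \<partial>lborel) = pi / 2"
proof -
  have c: "isCont (\<lambda>x. (sech_root 1 x)\<^sup>2) x" "isCont (\<lambda>x. sech_root 1 x ^ 6) x" for x
    using DERIV_isCont[OF DERIV_sech_root] by (auto intro!: continuous_intros)
  have d: "(mass_primitive has_real_derivative (sech_root 1 x)\<^sup>2) (at x)"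
    "(sextic_primitive has_real_derivative sech_root 1 x ^ 6) (at x)" for x
    using DERIV_mass_primitive DERIV_sextic_primitive by (simp_all add: sech_root_power2 sech_root_power6)
  show "integrable lborel (\<lambda>x. (sech_root 1 x)\<^sup>2)" "(\<integral>x. (sech_root 1 x)\<^sup>2 \<partial>lborel) = pi"
    using integral_UNIV_FTC_nonneg[OF d(1) c(1) _ mass_primitive_at_bot mass_primitive_at_top] by auto
  show "integrable lborel (\<lambda>x. sech_root 1 x ^ 6)" "(\<integral>x. sech_root 1 x ^ 6 \<partial>lborel) = pi / 2"
    using integral_UNIV_FTC_nonneg[OF d(2) c(2) _ sextic_primitive_at_bot sextic_primitive_at_top] by auto
qed

lemma G_ratio_sech_root:
  "H1_R (sech_root 1) (sech_root_deriv 1)" "\<not> (AE x in lborel. sech_root 1 x = 0)"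
  "G_ratio (sech_root 1) (sech_root_deriv 1) = ennreal (pi\<^sup>2 / 4)"
proof -
  \<comment> \<open>A quarter of pi - pi/2, the mass minus the sextic integral. The ratio is then
    (pi/8) pi^2 / (pi/2) = pi^2/4.\<close>
  have d: "integrable lborel (\<lambda>x. (sech_root_deriv 1 x)\<^sup>2)" "(\<integral>x. (sech_root_deriv 1 x)\<^sup>2 \<partial>lborel) = pi / 8"
    using sech_root_UNIV by (simp_all add: sech_root_deriv_power2)
  have m: "sech_root 1 \<in> borel_measurable lborel" "sech_root_deriv 1 \<in> borel_measurable lborel"
    using borel_measurable_continuous_onI[OF continuous_on_sech_root]
      borel_measurable_continuous_onI[OF continuous_on_sech_root_deriv] by auto
  show "H1_R (sech_root 1) (sech_root_deriv 1)"
    unfolding H1_R_def using m sech_root_UNIV d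
    by (auto intro: primitive_on_imp_weak_deriv_UNIV primitive_on_sech_root)
  show "\<not> (AE x in lborel. sech_root 1 x = 0)"
  proof
    assume "AE x in lborel. sech_root 1 x = 0"
    then have "(\<integral>x. (sech_root 1 x)\<^sup>2 \<partial>lborel) = 0"
      by (intro integral_eq_zero_AE) (auto elim!: eventually_mono)
    then show False using sech_root_UNIV(2) by simp
  qed
  have "(\<integral>\<^sup>+ x. ennreal ((sech_root_deriv 1 x)\<^sup>2) \<partial>lborel) = ennreal (pi / 8)"
    using nn_integral_eq_integral[OF d(1)] d(2) by simp
  moreover have "(\<integral>\<^sup>+ x. ennreal ((sech_root 1 x)\<^sup>2) \<partial>lborel) = ennreal pi"
    using nn_integral_eq_integral[OF sech_root_UNIV(1)] sech_root_UNIV(2) by simp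
  moreover have "(\<integral>\<^sup>+ x. ennreal (sech_root 1 x ^ 6) \<partial>lborel) = ennreal (pi / 2)"
    using nn_integral_eq_integral[OF sech_root_UNIV(3)] sech_root_UNIV(4) by simp
  ultimately show "G_ratio (sech_root 1) (sech_root_deriv 1) = ennreal (pi\<^sup>2 / 4)"
    unfolding G_ratio_def
    by (simp add: ennreal_power ennreal_mult[symmetric] divide_ennreal power2_eq_square)
qed

lemma G1_eq: "G1 = ennreal (pi\<^sup>2 / 4)"
proof (rule antisym)
  show "G1 \<le> ennreal (pi\<^sup>2 / 4)"
    unfolding G1_def using G_ratio_sech_root
    by (intro Inf_lower CollectI exI[of _ "sech_root 1"] exI[of _ "sech_root_deriv 1"]) auto
  show "ennreal (pi\<^sup>2 / 4) \<le> G1"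
    unfolding G1_def using G_ratio_ge by (intro Inf_greatest) auto
qed

section \<open>Upper bound from profiles concentrating at an endpoint\<close>

text \<open>Bernoulli's inequality for (1 - m/u)^6, where the even exponent admits any size of m/u.
  Weakening u^5 to u^2 expresses the loss through the mass, whose integral is already known.\<close>

lemma sixth_power_diff_ge:
  fixes u m :: real
  assumes "0 < u" "u \<le> 1" "0 \<le> m"
  shows "u ^ 6 - 6 * m * u\<^sup>2 \<le> \<bar>u - m\<bar> ^ 6"
proof -
  have "u ^ 6 * (1 + real 6 * (- m / u)) \<le> u ^ 6 * (1 + (- m / u)) ^ 6"
    using assms by (intro mult_left_mono Bernoulli_inequality_even) auto
  also have "u ^ 6 * (1 + (- m / u)) ^ 6 = (u - m) ^ 6"
    using assms by (simp flip: power_mult_distrib add: algebra_simps)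
  also have "u ^ 6 * (1 + real 6 * (- m / u)) = u ^ 6 - 6 * m * u ^ 5"
    using assms by (simp add: field_simps eval_nat_numeral)
  finally have "u ^ 6 - 6 * m * u ^ 5 \<le> \<bar>u - m\<bar> ^ 6" by (simp add: power_even_abs)
  moreover have "6 * m * u ^ 5 \<le> 6 * m * u\<^sup>2"
    using assms by (intro mult_left_mono power_decreasing) auto
  ultimately show ?thesis by linarith
qed

text \<open>On [0,1] the profile has mass s/l, sextic integral t/l and energy l(s - t)/4, so the
  powers of l cancel in the quotient. The only trace of l besides s and t is the correction for the
  mean, which is at most the square root of the mass s/l.\<close>

lemma GQ1_le_sech_root:
  fixes l :: real
  defines "s \<equiv> mass_primitive l" and "t \<equiv> sextic_primitive l"
  assumes l: "l > 0" and q: "0 < t - 6 * s * sqrt (s / l)"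
  shows "GQ1 \<le> ennreal ((s - t) * s\<^sup>2 / (4 * (t - 6 * s * sqrt (s / l))))"
proof -
  define u g where "u = sech_root l" and "g = sech_root_deriv l"
  have cu: "continuous_on S u" for S unfolding u_def by (rule continuous_on_sech_root)
  have cg: "continuous_on S g" for S unfolding g_def by (rule continuous_on_sech_root_deriv)
  have si: "set_integrable lborel {0..1} f" if "continuous_on {0..1} f" for f :: "real \<Rightarrow> real"
    using that by (rule borel_integrable_atLeastAtMost')
  have p: "primitive_on 0 1 u g" unfolding u_def g_def by (rule primitive_on_sech_root)
  have const: "(LINT x:{0..1::real}|lborel. c) = (c::real)" for c
    by (simp add: set_lebesgue_integral_def)
  have adm: "GQ_admissible u g"
    unfolding GQ_admissible_def
  proof
    show "W11_I u g"
      unfolding W11_I_def set_integrable_Ioo_iff_Icc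
      using primitive_on_imp_weak_deriv[OF p] by (auto intro!: si cu cg)
    show "\<nexists>c. AE x in lborel. x \<in> {0..1} \<longrightarrow> u x = c"
    proof
      assume "\<exists>c. AE x in lborel. x \<in> {0..1} \<longrightarrow> u x = c"
      then obtain c where c: "AE x in lborel. x \<in> {0..1} \<longrightarrow> u x = c" by blast
      have "u 0 \<noteq> u 1"
        using cosh_real_strict_mono[of 0 l] l by (auto simp: u_def sech_root_def)
      then obtain y where y: "y \<in> {0..1}" "u y \<noteq> c" by (metis atLeastAtMost_iff order_refl zero_le_one)
      have "0 < (LINT x:{0..1}|lborel. (u x - c)\<^sup>2)"
        using y by (intro LINT_pos[of _ _ _ y] continuous_intros cu) auto
      moreover have "(LINT x:{0..1}|lborel. (u x - c)\<^sup>2) = 0"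
        unfolding set_lebesgue_integral_def
        by (rule integral_eq_zero_AE) (use c in \<open>auto elim!: eventually_mono simp: indicator_def\<close>)
      ultimately show False by simp
    qed
  qed
  have sc: "primitive_on 0 1 (\<lambda>x. F (l * x) / l) (\<lambda>x. f x)"
    if "\<And>y. (F has_real_derivative f (y / l)) (at y)" "continuous_on {0..1} f" for F f
  proof (rule primitive_on_C1)
    fix x
    have "((\<lambda>x. F (l * x) / l) has_real_derivative f (l * x / l) * l / l) (at x within {0..1})"
      by (intro DERIV_cdivide DERIV_chain2[OF that(1)]) (auto intro!: derivative_eq_intros)
    then show "((\<lambda>x. F (l * x) / l) has_real_derivative f x) (at x within {0..1})" using l by simp
  qed fact
  define M S D where "M = (LINT x:{0..1}|lborel. (u x)\<^sup>2)" and "S = (LINT x:{0..1}|lborel. u x ^ 6)"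
    and "D = (LINT x:{0..1}|lborel. (g x)\<^sup>2)"
  have "primitive_on 0 1 (\<lambda>x. mass_primitive (l * x) / l) (\<lambda>x. (u x)\<^sup>2)"
    using DERIV_mass_primitive l by (intro sc continuous_intros cu) (simp add: u_def sech_root_power2)
  from primitive_on_LINT[OF this, of 0 1] have M: "M = s / l"
    by (simp add: M_def s_def mass_primitive_def)
  have "primitive_on 0 1 (\<lambda>x. sextic_primitive (l * x) / l) (\<lambda>x. u x ^ 6)"
    using DERIV_sextic_primitive l by (intro sc continuous_intros cu) (simp add: u_def sech_root_power6)
  from primitive_on_LINT[OF this, of 0 1] have S: "S = t / l"
    by (simp add: S_def t_def sextic_primitive_def)
  have i2: "set_integrable lborel {0..1} (\<lambda>x. (u x)\<^sup>2)" and i6: "set_integrable lborel {0..1} (\<lambda>x. u x ^ 6)"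
    by (intro si continuous_intros cu)+
  have "D = l\<^sup>2 / 4 * (M - S)"
    unfolding D_def M_def S_def g_def u_def sech_root_deriv_power2
    using i2 i6 by (simp add: u_def)
  then have D: "D = l * (s - t) / 4" using l by (simp add: M S power2_eq_square flip: diff_divide_distrib)
  have D0: "D \<ge> 0" and M0: "M \<ge> 0"
    unfolding D_def M_def set_lebesgue_integral_def by (intro integral_nonneg_AE AE_I2; auto)+
  define m where "m = mean_I u"
  have m_eq: "m = (LINT x:{0..1}|lborel. u x)" by (simp add: m_def mean_I_def)
  have m0: "m \<ge> 0" unfolding m_eq set_lebesgue_integral_def
    using sech_root_bounds(1) by (intro integral_nonneg_AE AE_I2) (auto simp: u_def less_imp_le)
  \<comment> \<open>Nonnegative variance, which yields m^2 \<le> M.\<close>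
  have "0 \<le> (LINT x:{0..1}|lborel. (u x - m)\<^sup>2)"
    unfolding set_lebesgue_integral_def by (intro integral_nonneg_AE AE_I2) auto
  also have "\<dots> = (LINT x:{0..1}|lborel. (u x)\<^sup>2 - 2 * m * u x + m\<^sup>2)"
    by (simp add: power2_eq_square algebra_simps)
  also have "\<dots> = M - m\<^sup>2"
    using i2 si[OF cu] si[OF continuous_on_const]
    by (simp add: M_def const m_eq[symmetric] power2_eq_square)
  finally have "m\<^sup>2 \<le> s / l" using M by simp
  then have ms: "m \<le> sqrt (s / l)" by (simp add: real_le_rsqrt)
  have s0: "s \<ge> 0" using M M0 l by (simp add: zero_le_divide_iff)
  define X where "X = (LINT x:{0..1}|lborel. \<bar>u x - m\<bar> ^ 6)"
  have iX: "set_integrable lborel {0..1} (\<lambda>x. \<bar>u x - m\<bar> ^ 6)" by (intro si continuous_intros cu)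
  have "(t - 6 * s * sqrt (s / l)) / l \<le> (t - 6 * s * m) / l"
    using ms s0 l by (intro divide_right_mono diff_left_mono mult_left_mono) auto
  also have "\<dots> = S - 6 * m * M" using l by (simp add: M S field_simps)
  also have "\<dots> = (LINT x:{0..1}|lborel. u x ^ 6 - 6 * m * (u x)\<^sup>2)"
    using i2 i6 by (simp add: M_def S_def)
  also have "\<dots> \<le> X"
    unfolding X_def using i2 i6 iX m0 sech_root_bounds
    by (intro set_integral_mono sixth_power_diff_ge) (auto simp: u_def)
  finally have X: "(t - 6 * s * sqrt (s / l)) / l \<le> X" .
  have X0: "X > 0" using X q l by (meson divide_pos_pos less_le_trans)
  have "GQ_ratio u g = ennreal (D * M\<^sup>2 / X)"
  proof -
    have "(\<integral>\<^sup>+ x\<in>{0..1}. ennreal ((g x)\<^sup>2) \<partial>lborel) = ennreal D"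
      unfolding D_def by (intro set_nn_integral_eq_LINT si continuous_intros cg) auto
    moreover have "(\<integral>\<^sup>+ x\<in>{0..1}. ennreal ((u x)\<^sup>2) \<partial>lborel) = ennreal M"
      unfolding M_def by (intro set_nn_integral_eq_LINT si continuous_intros cu) auto
    moreover have "(\<integral>\<^sup>+ x\<in>{0..1}. ennreal (\<bar>u x - mean_I u\<bar>^6) \<partial>lborel) = ennreal X"
      unfolding X_def m_def[symmetric] by (intro set_nn_integral_eq_LINT iX) auto
    ultimately show ?thesis
      unfolding GQ_ratio_def using X0 D0 M0
      by (simp add: ennreal_power ennreal_mult[symmetric] divide_ennreal)
  qed
  moreover have "GQ1 \<le> GQ_ratio u g"
    unfolding GQ1_def using adm by (intro Inf_lower) blast
  moreover have "D * M\<^sup>2 / X \<le> D * M\<^sup>2 / ((t - 6 * s * sqrt (s / l)) / l)"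
    using X q l D0 M0 X0 by (intro divide_left_mono) auto
  moreover have "D * M\<^sup>2 / ((t - 6 * s * sqrt (s / l)) / l) = (s - t) * s\<^sup>2 / (4 * (t - 6 * s * sqrt (s / l)))"
    using l q by (simp add: D M power2_eq_square)
  ultimately show ?thesis by (metis ennreal_leI order_trans)
qed

lemma GQ1_eq: "GQ1 = ennreal (pi\<^sup>2 / 16)"
proof (rule antisym)
  have ident: "filterlim (\<lambda>l::real. l) at_top at_top" by (rule filterlim_ident)
  have "((\<lambda>l. mass_primitive l / l) \<longlongrightarrow> 0) at_top"
    by (rule tendsto_divide_0[OF mass_primitive_at_top filterlim_at_top_imp_at_infinity[OF ident]])
  note sq = tendsto_real_sqrt[OF this]
  have "((\<lambda>l. sextic_primitive l - 6 * mass_primitive l * sqrt (mass_primitive l / l)) \<longlongrightarrow> pi / 4 - 6 * (pi / 2) * sqrt 0) at_top"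
    by (intro sq tendsto_diff tendsto_mult tendsto_const mass_primitive_at_top sextic_primitive_at_top)
  then have q: "((\<lambda>l. sextic_primitive l - 6 * mass_primitive l * sqrt (mass_primitive l / l)) \<longlongrightarrow> pi / 4) at_top"
    by simp
  have "((\<lambda>l. (mass_primitive l - sextic_primitive l) * (mass_primitive l)\<^sup>2
        / (4 * (sextic_primitive l - 6 * mass_primitive l * sqrt (mass_primitive l / l))))
      \<longlongrightarrow> (pi / 2 - pi / 4) * (pi / 2)\<^sup>2 / (4 * (pi / 4))) at_top"
    by (intro tendsto_intros q mass_primitive_at_top sextic_primitive_at_top) simp
  \<comment> \<open>Here pi/2 and pi/4 are half the mass and sextic integrals of the profile on the
    line. The energy is halved too, so the line quotient is multiplied by (1/2)(1/2)^2/(1/2) = 1/4;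
    this is the origin of the factor 4.\<close>
  also have "(pi / 2 - pi / 4) * (pi / 2)\<^sup>2 / (4 * (pi / 4)) = pi\<^sup>2 / 16"
    by (simp add: power2_eq_square field_simps)
  finally have "((\<lambda>l. ennreal ((mass_primitive l - sextic_primitive l) * (mass_primitive l)\<^sup>2
        / (4 * (sextic_primitive l - 6 * mass_primitive l * sqrt (mass_primitive l / l)))))
      \<longlongrightarrow> ennreal (pi\<^sup>2 / 16)) at_top"
    by (rule tendsto_ennrealI)
  moreover have "eventually (\<lambda>l. 0 < sextic_primitive l - 6 * mass_primitive l * sqrt (mass_primitive l / l)) at_top"
    using q by (rule order_tendstoD(1)) simp
  then have "eventually (\<lambda>l. GQ1 \<le> ennreal ((mass_primitive l - sextic_primitive l) * (mass_primitive l)\<^sup>2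
        / (4 * (sextic_primitive l - 6 * mass_primitive l * sqrt (mass_primitive l / l))))) at_top"
    using eventually_gt_at_top[of 0] by eventually_elim (rule GQ1_le_sech_root)
  ultimately show "GQ1 \<le> ennreal (pi\<^sup>2 / 16)"
    by (rule tendsto_lowerbound) simp
  show "ennreal (pi\<^sup>2 / 16) \<le> GQ1"
    unfolding GQ1_def using GQ_ratio_gt by (intro Inf_greatest) (auto intro: less_imp_le)
qed

theorem theorem4p2:
  shows "GQ1 = G1 / 4 \<and> G1 / 4 = ennreal (pi^2 / 16) \<and>
         \<not> (\<exists>u g. GQ_admissible u g \<and> GQ_ratio u g = GQ1)"
proof -
  have "G1 / 4 = ennreal (pi\<^sup>2 / 4) / ennreal 4" by (simp add: G1_eq)
  also have "\<dots> = ennreal (pi\<^sup>2 / 16)" by (subst divide_ennreal) simp_all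
  finally have "G1 / 4 = ennreal (pi\<^sup>2 / 16)" .
  \<comment> \<open>Non-attainment: every admissible ratio lies strictly above pi^2/16, which is the
    value of the infimum.\<close>
  then show ?thesis
    using GQ_ratio_gt GQ1_eq by (metis less_irrefl)
qed

end
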